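(* Let $s,t$ be complex numbers with $\mathrm{Re}\,s>-1$ and $\mathrm{Re}\,t>-1$, and put $Z(s,t;x-1,x+1)=\int_0^1|2\sin\pi\theta|^s|2\cos\pi\theta|^t\,d\theta$. Then: (i) \[Z(s,t;x-1,x+1)=\frac{\Gamma(s+1)\Gamma(t+1)}{\Gamma(\frac s2+1)\Gamma(\frac t2+1)\Gamma(\frac{s+t}{2}+1)}=\prod_{n=1}^\infty\frac{(1+\frac{s}{2n})(1+\frac{t}{2n})(1+\frac{s+t}{2n})}{(1+\frac sn)(1+\frac tn)}.\] (ii) Around $s=t=0$, \[Z(s,t;x-1,x+1)=\exp\left(\sum_{k=2}^\infty\frac{(-1)^k}{k}\zeta(k)\left\{(1-2^{-k})(s^k+t^k)-2^{-k}(s+t)^k\right\}\right),\] and this power series lies in $\mathbb{Q}[\pi^2,\zeta(3),\zeta(5),\dots][[s,t]]$. (iii) For all integers $k,l\ge0$, the number \[m(\underbrace{x-1,\dots,x-1}_k,\underbrace{x+1,\dots,x+1}_l)=\int_0^1(\log|2\sin\pi\theta|)^k(\log|2\cos\pi\theta|)^l\,d\theta\] belongs to $\mathbb{Q}[\pi^2,\zeta(3),\zeta(5),\zeta(7),\dots]$.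
   Context: $\zeta$ is the Riemann zeta function and $\Gamma$ the Gamma function. Note $|e^{2\pi i\theta}-1|=|2\sin\pi\theta|$ and $|e^{2\pi i\theta}+1|=|2\cos\pi\theta|$, so $Z(s,t;x-1,x+1)=\int_0^1|e^{2\pi i\theta}-1|^s|e^{2\pi i\theta}+1|^t\,d\theta$, and $m(P_1,\dots,P_l)=\int_0^1\prod_j\log|P_j(e^{2\pi i\theta})|\,d\theta$. *)

theory Defs
  imports "HOL-Analysis.Analysis"
begin

definition rzeta :: "nat \<Rightarrow> real" where
  "rzeta k = (\<Sum>n. 1 / (real (Suc n)) ^ k)"

inductive_set zeta_ring :: "real set" where
  rat: "x \<in> \<rat> \<Longrightarrow> x \<in> zeta_ring"
| pi2: "pi ^ 2 \<in> zeta_ring"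
| zodd: "j \<ge> 1 \<Longrightarrow> rzeta (2 * j + 1) \<in> zeta_ring"
| add: "x \<in> zeta_ring \<Longrightarrow> y \<in> zeta_ring \<Longrightarrow> x + y \<in> zeta_ring"
| mult: "x \<in> zeta_ring \<Longrightarrow> y \<in> zeta_ring \<Longrightarrow> x * y \<in> zeta_ring"

text \<open>Integrand of Z(s,t;x-1,x+1): |2 sin(pi theta)|^s |2 cos(pi theta)|^t,
  with complex powers of positive reals (value at the null set of zeros is irrelevant).\<close>
definition Zint :: "complex \<Rightarrow> complex \<Rightarrow> real \<Rightarrow> complex" where
  "Zint s t \<theta> = complex_of_real \<bar>2 * sin (pi * \<theta>)\<bar> powr s *
                  complex_of_real \<bar>2 * cos (pi * \<theta>)\<bar> powr t"

definition Zpm :: "complex \<Rightarrow> complex \<Rightarrow> complex" where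
  "Zpm s t = integral {0..1} (Zint s t)"

end

theory Submission
  imports Defs "HOL-Complex_Analysis.Complex_Analysis"
begin

text \<open>
  For real \<open>s, t > -1\<close> the substitution \<open>x = sin\<^sup>2 (pi * \<theta>)\<close> turns the integral into a Beta integral, and Legendre
  duplication gives the Gamma quotient. Writing the integrand as the exponential of
  \<open>s * ln \<bar>2 * sin (pi * \<theta>)\<bar> + t * ln \<bar>2 * cos (pi * \<theta>)\<bar>\<close> and expanding shows that the integral is holomorphic in each
  variable, so the identity extends to complex \<open>s, t\<close>, and that its double power series at the origin has the
  log-moments (divided by factorials) as coefficients. Taking logarithms in the infinite product and exchanging the two
  summations gives the exponential formula. On the line \<open>t = -s\<close> the Gamma quotient is \<open>1 / cos (pi * s / 2)\<close>, and the
  recurrence for the coefficients of the exponential of a power series, solved for the exponent, puts \<open>\<zeta> (2 * k)\<close> into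
  the ring. On the lines \<open>(s, t) = (x * u, u)\<close> the same recurrence, read forwards, puts the log-moments into the ring.
\<close>

subsection \<open>Integrals of exponentials\<close>

text \<open>Termwise integration of a double series. The pairs are enumerated by
  \<open>prod_decode\<close>, so the theorem on integrating an ordinary series applies;
  \<open>G\<close> dominates all partial sums of the norms, which bounds the integrals of the norms.
  The resulting absolute convergence turns the enumerated sum back into an unordered one.\<close>

lemma has_sum_integral_prod:
  fixes f :: "nat \<times> nat \<Rightarrow> 'a \<Rightarrow> 'b :: {banach, second_countable_topology}"
  assumes meas: "\<And>i. f i \<in> borel_measurable M"
    and F: "\<And>x. x \<in> space M \<Longrightarrow> ((\<lambda>i. f i x) has_sum F x) UNIV"
    and G: "\<And>x. x \<in> space M \<Longrightarrow> ((\<lambda>i. norm (f i x)) has_sum G x) UNIV"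
    and int: "integrable M G"
  shows "((\<lambda>i. integral\<^sup>L M (f i)) has_sum integral\<^sup>L M F) UNIV"
proof -
  have le: "(\<Sum>i\<in>I. norm (f i x)) \<le> G x" if "x \<in> space M" "finite I" for I x
    using has_sum_mono_neutral[of "\<lambda>i. norm (f i x)" I "\<Sum>i\<in>I. norm (f i x)" "\<lambda>i. norm (f i x)" UNIV "G x"]
      G[OF that(1)] that(2) by (auto simp: has_sum_finite_iff)
  have int_f: "integrable M (f i)" for i
    by (rule Bochner_Integration.integrable_bound[OF int meas])
       (use le[of _ "{i}"] in \<open>force intro!: AE_I2\<close>)
  have bij: "bij_betw prod_decode UNIV UNIV"
    by (rule bij_prod_decode)
  define g where "g = (\<lambda>n. f (prod_decode n))"
  have gF: "((\<lambda>n. g n x) has_sum F x) UNIV" "((\<lambda>n. norm (g n x)) has_sum G x) UNIV"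
    if "x \<in> space M" for x
    using F[OF that] G[OF that]
    by (simp_all add: g_def has_sum_reindex_bij_betw[OF bij, of "\<lambda>i. f i x"]
        has_sum_reindex_bij_betw[OF bij, of "\<lambda>i. norm (f i x)"])
  have summ: "summable (\<lambda>n. \<integral>x. norm (g n x) \<partial>M)"
  proof (rule bounded_imp_summable)
    fix n
    have "(\<Sum>k\<le>n. \<integral>x. norm (g k x) \<partial>M) = (\<integral>x. (\<Sum>k\<le>n. norm (g k x)) \<partial>M)"
      by (subst Bochner_Integration.integral_sum) (auto simp: g_def int_f)
    also have "\<dots> \<le> integral\<^sup>L M G"
    proof (rule integral_mono[OF _ int])
      show "integrable M (\<lambda>x. \<Sum>k\<le>n. norm (g k x))"
        by (auto simp: g_def int_f)
      fix x assume "x \<in> space M"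
      then show "(\<Sum>k\<le>n. norm (g k x)) \<le> G x"
        using le[of x "prod_decode ` {..n}"]
        by (simp add: sum.reindex inj_prod_decode g_def)
    qed
    finally show "(\<Sum>k\<le>n. \<integral>x. norm (g k x) \<partial>M) \<le> integral\<^sup>L M G" .
  qed auto
  have AE: "AE x in M. summable (\<lambda>n. norm (g n x))"
    using gF(2) by (intro AE_I2) (meson has_sum_imp_sums sums_summable)
  have "(\<lambda>n. integral\<^sup>L M (g n)) sums (\<integral>x. (\<Sum>n. g n x) \<partial>M)"
    by (rule sums_integral[OF _ AE summ]) (simp add: g_def int_f)
  also have "(\<integral>x. (\<Sum>n. g n x) \<partial>M) = integral\<^sup>L M F"
    by (rule Bochner_Integration.integral_cong[OF refl])
       (metis gF(1) has_sum_imp_sums sums_unique)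
  finally have *: "(\<lambda>n. integral\<^sup>L M (g n)) sums integral\<^sup>L M F" .
  have "summable (\<lambda>n. norm (integral\<^sup>L M (g n)))"
    by (rule summable_comparison_test[OF _ summ])
       (auto intro!: exI[of _ 0] integral_norm_bound)
  from norm_summable_imp_has_sum[OF this *]
  show "((\<lambda>i. integral\<^sup>L M (f i)) has_sum integral\<^sup>L M F) UNIV"
    using has_sum_reindex_bij_betw[OF bij, of "\<lambda>i. integral\<^sup>L M (f i)"] by (simp add: g_def)
qed

lemma has_sum_exp:
  fixes z :: "'a :: {banach, real_normed_field}"
  shows "((\<lambda>n. z ^ n / fact n) has_sum exp z) UNIV"
proof (rule norm_summable_imp_has_sum)
  show "summable (\<lambda>n. norm (z ^ n / fact n))"
    using summable_norm_exp[of z] by (simp add: norm_divide norm_mult norm_inverse field_simps)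
  show "(\<lambda>n. z ^ n / fact n) sums exp z"
    using exp_converges[of z] by (simp add: scaleR_conv_of_real field_simps)
qed

text \<open>The Cauchy product of two exponential series as an unordered sum: absolute summability
  over the pairs comes from the row sums of norms, and the value from summing first over
  \<open>b\<close>, then over \<open>a\<close>.\<close>

lemma has_sum_exp_times_exp:
  fixes w z z' :: complex
  shows "((\<lambda>(a, b). w * (z ^ a / fact a * (z' ^ b / fact b))) has_sum w * exp (z + z')) UNIV"
proof -
  have *: "((\<lambda>n. norm (z ^ n / fact n)) has_sum exp (norm z)) UNIV" for z :: complex
    using has_sum_exp[of "norm z"] by (simp add: norm_divide norm_power)
  have "(\<lambda>i. norm (case i of (a, b) \<Rightarrow> z ^ a / fact a * (z' ^ b / fact b))) summable_on UNIV \<times> UNIV"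
  proof (rule summable_on_SigmaI)
    show "((\<lambda>b. norm (case (a, b) of (a, b) \<Rightarrow> z ^ a / fact a * (z' ^ b / fact b)))
        has_sum norm (z ^ a / fact a) * exp (norm z')) UNIV" for a
      using has_sum_cmult_right[OF *, of "norm (z ^ a / fact a)" z'] by (simp only: prod.case norm_mult)
    show "(\<lambda>a. norm (z ^ a / fact a) * exp (norm z')) summable_on UNIV"
      using has_sum_cmult_left[OF *] by (auto simp: summable_on_def)
  qed auto
  then have "(\<lambda>(a, b). z ^ a / fact a * (z' ^ b / fact b)) summable_on UNIV \<times> UNIV"
    by (rule abs_summable_summable)
  then have "((\<lambda>(a, b). z ^ a / fact a * (z' ^ b / fact b)) has_sum exp z * exp z') (UNIV \<times> UNIV)"
    by (rule has_sum_SigmaI[where g = "\<lambda>a. z ^ a / fact a * exp z'", rotated 2])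
       (simp_all only: prod.case has_sum_cmult_right has_sum_cmult_left has_sum_exp)
  from has_sum_cmult_right[OF this, of w] show ?thesis
    by (simp add: case_prod_unfold exp_add)
qed

text \<open>Both exponentials are expanded and integrated term by term. The norms of the terms add
  up to \<open>norm (w x) * exp (norm s * \<bar>h x\<bar> + norm t * \<bar>g x\<bar>)\<close>, which
  the integrable function in the hypothesis dominates.\<close>

lemma exp_moments_has_sum:
  fixes w :: "'a \<Rightarrow> complex" and h g :: "'a \<Rightarrow> real"
  assumes meas [measurable]: "w \<in> borel_measurable M" "h \<in> borel_measurable M" "g \<in> borel_measurable M"
    and int: "integrable M (\<lambda>x. norm (w x) * exp (r * (\<bar>h x\<bar> + \<bar>g x\<bar>)))"
    and st: "norm s \<le> r" "norm t \<le> r"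
  shows "((\<lambda>(a, b). (\<integral>x. w x * complex_of_real (h x ^ a * g x ^ b) \<partial>M) / (fact a * fact b) * s ^ a * t ^ b)
           has_sum (\<integral>x. w x * exp (s * complex_of_real (h x) + t * complex_of_real (g x)) \<partial>M)) UNIV"
proof -
  define f where "f = (\<lambda>(a, b) x. w x * ((s * complex_of_real (h x)) ^ a / fact a * ((t * complex_of_real (g x)) ^ b / fact b)))"
  have "((\<lambda>i. integral\<^sup>L M (f i)) has_sum
      (\<integral>x. w x * exp (s * complex_of_real (h x) + t * complex_of_real (g x)) \<partial>M)) UNIV"
  proof (rule has_sum_integral_prod)
    show "f i \<in> borel_measurable M" for i
      by (cases i) (simp add: f_def)
    show "((\<lambda>i. f i x) has_sum w x * exp (s * complex_of_real (h x) + t * complex_of_real (g x))) UNIV" for x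
      using has_sum_exp_times_exp[of "w x"] by (simp add: f_def case_prod_unfold)
    show "((\<lambda>i. norm (f i x)) has_sum norm (w x) * exp (norm s * \<bar>h x\<bar> + norm t * \<bar>g x\<bar>)) UNIV" for x
    proof -
      \<comment> \<open>The series of norms is the same complex identity, with every quantity
        replaced by its absolute value; injectivity of \<open>complex_of_real\<close> brings it back
        to the reals.\<close>
      have "((\<lambda>i. complex_of_real (norm (f i x))) has_sum
           complex_of_real (norm (w x) * exp (norm s * \<bar>h x\<bar> + norm t * \<bar>g x\<bar>))) UNIV"
        using has_sum_exp_times_exp[of "complex_of_real (norm (w x))"
            "complex_of_real (norm s * \<bar>h x\<bar>)" "complex_of_real (norm t * \<bar>g x\<bar>)"]
        by (simp add: f_def case_prod_unfold norm_mult norm_divide norm_power exp_of_real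
            flip: exp_of_real)
      then show ?thesis
        by (simp only: has_sum_of_real_iff)
    qed
    show "integrable M (\<lambda>x. norm (w x) * exp (norm s * \<bar>h x\<bar> + norm t * \<bar>g x\<bar>))"
      by (rule Bochner_Integration.integrable_bound[OF int])
         (use st in \<open>auto intro!: AE_I2 mult_left_mono add_mono mult_right_mono simp: distrib_left\<close>)
  qed
  also have "(\<lambda>i. integral\<^sup>L M (f i)) =
     (\<lambda>(a, b). (\<integral>x. w x * complex_of_real (h x ^ a * g x ^ b) \<partial>M) / (fact a * fact b) * s ^ a * t ^ b)"
  proof (rule ext, clarify)
    fix a b
    have "f (a, b) = (\<lambda>x. (s ^ a * t ^ b / (fact a * fact b)) * (w x * complex_of_real (h x ^ a * g x ^ b)))"
      by (auto simp: f_def power_mult_distrib fun_eq_iff)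
    then show "integral\<^sup>L M (f (a, b)) =
       (\<integral>x. w x * complex_of_real (h x ^ a * g x ^ b) \<partial>M) / (fact a * fact b) * s ^ a * t ^ b"
      by simp
  qed
  finally show ?thesis .
qed

text \<open>The one-variable case: with second function 0 and second exponent 0, the factor
  \<open>0 ^ b\<close> leaves only the pairs \<open>(a, 0)\<close>.\<close>

lemma exp_integral_sums:
  fixes w :: "'a \<Rightarrow> complex" and h :: "'a \<Rightarrow> real"
  assumes meas [measurable]: "w \<in> borel_measurable M" "h \<in> borel_measurable M"
    and int: "integrable M (\<lambda>x. norm (w x) * exp (r * \<bar>h x\<bar>))"
    and z: "norm z \<le> r"
  shows "(\<lambda>a. (\<integral>x. w x * complex_of_real (h x ^ a) \<partial>M) / fact a * z ^ a) sums
           (\<integral>x. w x * exp (z * complex_of_real (h x)) \<partial>M)"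
proof -
  have "r \<ge> 0"
    using z norm_ge_zero[of z] by linarith
  let ?f = "\<lambda>(a, b). (\<integral>x. w x * complex_of_real (h x ^ a * 0 ^ b) \<partial>M) / (fact a * fact b) * z ^ a * 0 ^ b"
  have "(?f has_sum (\<integral>x. w x * exp (z * complex_of_real (h x)) \<partial>M)) UNIV"
    using exp_moments_has_sum[of w M h "\<lambda>_. 0" r z 0] int z \<open>r \<ge> 0\<close> by simp
  also have "?this \<longleftrightarrow> ((\<lambda>i. ?f i) has_sum (\<integral>x. w x * exp (z * complex_of_real (h x)) \<partial>M)) (range (\<lambda>a. (a, 0)))"
    by (rule has_sum_cong_neutral) (auto simp: image_iff power_0_left)
  also have "\<dots> \<longleftrightarrow> ((\<lambda>a. ?f (a, 0)) has_sum (\<integral>x. w x * exp (z * complex_of_real (h x)) \<partial>M)) UNIV"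
    by (subst has_sum_reindex) (auto simp: inj_on_def o_def)
  finally show ?thesis
    by (auto dest: has_sum_imp_sums)
qed

text \<open>Near a point \<open>z0\<close> the factor \<open>exp (z0 * h x)\<close> is absorbed into
  the weight, giving a power series in \<open>z - z0\<close>. The required two-sided bound follows
  from \<open>exp (r * \<bar>h\<bar>) \<le> exp (r * h) + exp (- r * h)\<close> and integrability at
  the two real exponents \<open>Re z0 - r\<close> and \<open>Re z0 + r\<close>.\<close>

lemma exp_integral_holomorphic:
  fixes w :: "'a \<Rightarrow> complex" and h :: "'a \<Rightarrow> real"
  assumes meas [measurable]: "w \<in> borel_measurable M" "h \<in> borel_measurable M"
    and int: "\<And>\<sigma>. \<sigma> > c \<Longrightarrow> integrable M (\<lambda>x. norm (w x) * exp (\<sigma> * h x))"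
  shows "(\<lambda>z. \<integral>x. w x * exp (z * complex_of_real (h x)) \<partial>M) holomorphic_on {z. Re z > c}"
proof -
  have "\<exists>e>0. (\<lambda>z. \<integral>x. w x * exp (z * complex_of_real (h x)) \<partial>M) holomorphic_on ball z0 e"
    if z0: "Re z0 > c" for z0
  proof -
    \<comment> \<open>Half the distance from \<open>z0\<close> to the boundary line, so that
      \<open>Re z0 - r\<close> is still larger than \<open>c\<close>.\<close>
    define r where "r = (Re z0 - c) / 2"
    have r: "r > 0" "Re z0 - r > c" "Re z0 + r > c"
      using z0 by (auto simp: r_def field_simps)
    define v where "v = (\<lambda>x. w x * exp (z0 * complex_of_real (h x)))"
    have [measurable]: "v \<in> borel_measurable M"
      by (simp add: v_def)
    have "integrable M (\<lambda>x. norm (w x) * exp ((Re z0 - r) * h x) + norm (w x) * exp ((Re z0 + r) * h x))"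
      by (intro Bochner_Integration.integrable_add int r)
    then have int_v: "integrable M (\<lambda>x. norm (v x) * exp (r * \<bar>h x\<bar>))"
    proof (rule Bochner_Integration.integrable_bound)
      show "AE x in M. norm (norm (v x) * exp (r * \<bar>h x\<bar>)) \<le>
           norm (norm (w x) * exp ((Re z0 - r) * h x) + norm (w x) * exp ((Re z0 + r) * h x))"
      proof (rule AE_I2)
        fix x
        have "norm (norm (v x) * exp (r * \<bar>h x\<bar>)) = norm (w x) * (exp (Re z0 * h x) * exp (r * \<bar>h x\<bar>))"
          by (simp add: v_def norm_mult)
        also have "\<dots> \<le> norm (w x) * (exp ((Re z0 - r) * h x) + exp ((Re z0 + r) * h x))"
          by (intro mult_left_mono) (auto simp: abs_if algebra_simps simp flip: exp_add)
        also have "\<dots> \<le> norm (norm (w x) * exp ((Re z0 - r) * h x) + norm (w x) * exp ((Re z0 + r) * h x))"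
          by (simp add: distrib_left)
        finally show "norm (norm (v x) * exp (r * \<bar>h x\<bar>)) \<le>
           norm (norm (w x) * exp ((Re z0 - r) * h x) + norm (w x) * exp ((Re z0 + r) * h x))" .
      qed
    qed simp
    have "(\<lambda>z. \<integral>x. w x * exp (z * complex_of_real (h x)) \<partial>M) holomorphic_on ball z0 r"
    proof (rule power_series_holomorphic)
      fix z assume "z \<in> ball z0 r"
      then have "norm (z - z0) \<le> r"
        by (simp add: dist_norm norm_minus_commute)
      from exp_integral_sums[OF _ _ int_v this]
      have "(\<lambda>n. (\<integral>x. v x * complex_of_real (h x ^ n) \<partial>M) / fact n * (z - z0) ^ n) sums
          (\<integral>x. v x * exp ((z - z0) * complex_of_real (h x)) \<partial>M)"
        by simp
      also have "(\<lambda>x. v x * exp ((z - z0) * complex_of_real (h x))) = (\<lambda>x. w x * exp (z * complex_of_real (h x)))"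
        by (simp add: v_def fun_eq_iff algebra_simps flip: exp_add)
      finally show "(\<lambda>n. (\<integral>x. v x * complex_of_real (h x ^ n) \<partial>M) / fact n * (z - z0) ^ n) sums
          (\<integral>x. w x * exp (z * complex_of_real (h x)) \<partial>M)" .
    qed
    with r(1) show ?thesis by blast
  qed
  then have "(\<lambda>z. \<integral>x. w x * exp (z * complex_of_real (h x)) \<partial>M) analytic_on {z. Re z > c}"
    unfolding analytic_on_def by blast
  then show ?thesis
    by (rule analytic_imp_holomorphic)
qed

subsection \<open>The integral for real exponents\<close>

definition lsin :: "real \<Rightarrow> real" where
  "lsin \<theta> = ln \<bar>2 * sin (pi * \<theta>)\<bar>"

definition lcos :: "real \<Rightarrow> real" where
  "lcos \<theta> = ln \<bar>2 * cos (pi * \<theta>)\<bar>"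

text \<open>The points of the unit interval where both factors of the integrand are nonzero.\<close>
definition reg :: "real set" where
  "reg = {0<..<1/2} \<union> {1/2<..<1}"

text \<open>Polymorphic, so that the real Beta computation and its complex continuation share one
  formula.\<close>

definition Zgamma :: "'a :: Gamma \<Rightarrow> 'a \<Rightarrow> 'a" where
  "Zgamma s t = Gamma (s + 1) * Gamma (t + 1) /
     (Gamma (s / 2 + 1) * Gamma (t / 2 + 1) * Gamma ((s + t) / 2 + 1))"

lemma measurable_lsin [measurable]: "lsin \<in> borel_measurable borel"
  and measurable_lcos [measurable]: "lcos \<in> borel_measurable borel"
  unfolding lsin_def lcos_def by measurable

lemma reg_sets [measurable]: "reg \<in> sets borel"
  by (simp add: reg_def)

text \<open>Legendre duplication at \<open>z = (s + 1) / 2\<close>, where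
  \<open>z + 1/2 = s / 2 + 1\<close> and \<open>2 * z = s + 1\<close>; the complex formula is pulled
  back to the reals, and the positive factor \<open>Gamma (s / 2 + 1)\<close> is divided
  out.\<close>

lemma Gamma_half_real:
  fixes s :: real
  assumes "s > -1"
  shows "Gamma ((s + 1) / 2) = 2 powr (-s) * sqrt pi * Gamma (s + 1) / Gamma (s / 2 + 1)"
proof -
  define z where "z = (s + 1) / 2"
  have z: "z > 0"
    using assms by (simp add: z_def)
  have "Gamma (complex_of_real z) * Gamma (complex_of_real z + 1 / 2) =
      exp ((1 - 2 * complex_of_real z) * complex_of_real (ln 2)) * complex_of_real (sqrt pi) * Gamma (2 * complex_of_real z)"
    by (rule Gamma_legendre_duplication) (use z in \<open>auto elim!: nonpos_Ints_cases simp: complex_eq_iff\<close>)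
  also have "complex_of_real z + 1 / 2 = complex_of_real (s / 2 + 1)"
    by (simp add: z_def field_simps)
  also have "2 * complex_of_real z = complex_of_real (s + 1)"
    by (simp add: z_def field_simps)
  also have e: "exp ((1 - complex_of_real (s + 1)) * complex_of_real (ln 2)) = complex_of_real (exp (- s * ln 2))"
    by (simp flip: exp_of_real)
  finally have "complex_of_real (Gamma z * Gamma (s / 2 + 1)) =
      complex_of_real (exp (- s * ln 2) * sqrt pi * Gamma (s + 1))"
    using e by (simp only: Gamma_complex_of_real of_real_mult)
  then have "Gamma z * Gamma (s / 2 + 1) = exp (- s * ln 2) * sqrt pi * Gamma (s + 1)"
    by (simp only: of_real_eq_iff)
  moreover have "Gamma (s / 2 + 1) > 0"
    using assms by (intro Gamma_real_pos) auto
  ultimately show ?thesis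
    by (simp add: z_def powr_def field_simps)
qed

lemma Beta_conv_Zgamma:
  fixes s t :: real
  assumes "s > -1" "t > -1"
  shows "Beta ((s + 1) / 2) ((t + 1) / 2) = pi * 2 powr (- s - t) * Zgamma s t"
proof -
  have *: "(s + 1) / 2 + (t + 1) / 2 = (s + t) / 2 + 1"
    by (simp add: field_simps)
  have **: "2 powr - s * 2 powr - t = 2 powr (- s - t)"
    by (simp flip: powr_add)
  have "(2 powr - s * sqrt pi * a / c) * (2 powr - t * sqrt pi * b / d) / e =
      (sqrt pi * sqrt pi) * (2 powr - s * 2 powr - t) * (a * b / (c * d * e))" for a b c d e :: real
    by simp
  then show ?thesis
    unfolding Beta_def * Gamma_half_real[OF assms(1)] Gamma_half_real[OF assms(2)] Zgamma_def ** by simp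
qed

text \<open>On the first half of the interval,
  \<open>\<theta> \<mapsto> (sin (pi * \<theta>))\<^sup>2\<close> is a bijection onto the open unit
  interval, and it pulls the Beta integrand \<open>b\<close> back to a constant multiple of
  \<open>f\<close>.\<close>

lemma half_integral:
  fixes s t :: real
  assumes st: "s > -1" "t > -1"
  defines "f \<equiv> \<lambda>\<theta>. exp (s * lsin \<theta> + t * lcos \<theta>)"
  shows "set_integrable lborel {0<..<1/2} f" "(LINT \<theta>:{0<..<1/2}|lborel. f \<theta>) = Zgamma s t / 2"
proof -
  define b where "b = (\<lambda>x::real. x powr ((s + 1) / 2 - 1) * (1 - x) powr ((t + 1) / 2 - 1))"
  define g where "g = (\<lambda>\<theta>. (sin (pi * \<theta>))\<^sup>2)"
  define g' where "g' = (\<lambda>\<theta>. 2 * sin (pi * \<theta>) * (cos (pi * \<theta>) * pi))"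
  have pos: "sin (pi * \<theta>) > 0" "cos (pi * \<theta>) > 0" if "\<theta> \<in> {0<..<1/2}" for \<theta>
    using that by (auto intro!: sin_gt_zero cos_gt_zero_pi mult_strict_left_mono[of \<theta> "1/2" pi, simplified]
        simp: field_simps less_trans[OF _ mult_pos_pos])
  have b_int: "(b has_integral Beta ((s + 1) / 2) ((t + 1) / 2)) {0<..<1}"
    using has_integral_Beta_real[of "(s + 1) / 2" "(t + 1) / 2"] st
    by (simp add: b_def has_integral_Icc_iff_Ioo)
  then have b_abs: "b absolutely_integrable_on {0<..<1}"
    by (intro nonnegative_absolutely_integrable_1) (auto simp: b_def has_integral_iff)
  have "inj_on g {0<..<1/2}"
  proof (rule inj_onI)
    fix x y assume xy: "x \<in> {0<..<1/2}" "y \<in> {0<..<1/2::real}" "g x = g y"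
    then have "sin (pi * x) = sin (pi * y)"
      using pos(1)[of x] pos(1)[of y] by (simp add: g_def power2_eq_iff)
    moreover have "\<bar>pi * z\<bar> \<le> pi / 2" if "z \<in> {0<..<1/2}" for z
      using that by (auto simp: abs_mult field_simps)
    ultimately show "x = y"
      using xy sin_inj_pi[of "pi * x" "pi * y"] by (metis (no_types) abs_le_D1 abs_le_D2 minus_le_iff mult_cancel_left pi_neq_zero minus_divide_left)
  qed
  moreover have img: "g ` {0<..<1/2} = {0<..<1}"
  proof (intro equalityI subsetI)
    fix x assume "x \<in> g ` {0<..<1/2}"
    then obtain \<theta> where \<theta>: "x = g \<theta>" "\<theta> \<in> {0<..<1/2}" by blast
    have "x + (cos (pi * \<theta>))\<^sup>2 = 1" "x > 0" "(cos (pi * \<theta>))\<^sup>2 > 0"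
      using pos[OF \<theta>(2)] by (auto simp: \<theta>(1) g_def)
    then have "0 < x" "x < 1" by linarith+
    then show "x \<in> {0<..<1}" by simp
  next
    fix x :: real assume x: "x \<in> {0<..<1}"
    then have sx: "0 < sqrt x" "sqrt x < 1" by auto
    define \<theta> where "\<theta> = arcsin (sqrt x) / pi"
    have "0 < arcsin (sqrt x)"
      using sx arcsin_less_arcsin[of 0 "sqrt x"] by simp
    moreover have "arcsin (sqrt x) < pi / 2"
      using sx arcsin_lt_bounded[of "sqrt x"] by linarith
    ultimately have \<theta>_in: "\<theta> \<in> {0<..<1/2}"
      by (auto simp: \<theta>_def field_simps)
    have "sin (arcsin (sqrt x)) = sqrt x"
      using sx by (intro sin_arcsin) linarith+
    then have "g \<theta> = x"
      using x by (simp add: g_def \<theta>_def)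
    with \<theta>_in show "x \<in> g ` {0<..<1/2}" by blast
  qed
  moreover have "(g has_field_derivative g' \<theta>) (at \<theta> within {0<..<1/2})" for \<theta>
    unfolding g_def g'_def by (auto intro!: derivative_eq_intros)
  ultimately have cov: "(\<lambda>\<theta>. \<bar>g' \<theta>\<bar> * b (g \<theta>)) absolutely_integrable_on {0<..<1/2} \<and>
      integral {0<..<1/2} (\<lambda>\<theta>. \<bar>g' \<theta>\<bar> * b (g \<theta>)) = Beta ((s + 1) / 2) ((t + 1) / 2)"
    using has_absolute_integral_change_of_variables_1'[of "{0<..<1/2}" g g' b "Beta ((s + 1) / 2) ((t + 1) / 2)"]
      b_int b_abs by (simp add: has_integral_iff)
  have eqs: "(\<lambda>\<theta>. \<bar>g' \<theta>\<bar> * b (g \<theta>)) absolutely_integrable_on {0<..<1/2} \<longleftrightarrow>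
      (\<lambda>\<theta>. (2 * pi * 2 powr (- s - t)) * f \<theta>) absolutely_integrable_on {0<..<1/2}"
    and eqs': "integral {0<..<1/2} (\<lambda>\<theta>. \<bar>g' \<theta>\<bar> * b (g \<theta>)) =
      integral {0<..<1/2} (\<lambda>\<theta>. (2 * pi * 2 powr (- s - t)) * f \<theta>)"
  proof -
    \<comment> \<open>The factor \<open>2 * pi\<close> comes from the derivative of the
      substitution; \<open>2 powr (- s - t)\<close> compensates for the twos inside
      \<open>2 * sin\<close> and \<open>2 * cos\<close>.\<close>
    have eq: "\<bar>g' \<theta>\<bar> * b (g \<theta>) = (2 * pi * 2 powr (- s - t)) * f \<theta>" if \<theta>: "\<theta> \<in> {0<..<1/2}" for \<theta>
    proof -
      note p = pos[OF \<theta>]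
      have c2: "1 - (sin (pi * \<theta>))\<^sup>2 = (cos (pi * \<theta>))\<^sup>2"
        by (simp add: cos_squared_eq)
      \<comment> \<open>For \<open>y\<close> the sine or the cosine, the power equals
        \<open>y powr (a - 1)\<close>; the quotient by \<open>y\<close> cancels against the sine and
        cosine in \<open>g'\<close>.\<close>
      have pw: "y\<^sup>2 powr ((a + 1) / 2 - 1) = exp (a * ln y) / y" if "y > 0" for y a :: real
      proof -
        have "y\<^sup>2 powr ((a + 1) / 2 - 1) = exp ((a - 1) * ln y)"
          using that by (simp add: powr_def ln_realpow field_simps)
        also have "\<dots> = exp (a * ln y) / y"
          using that by (simp add: left_diff_distrib exp_diff)
        finally show ?thesis .
      qed
      have "\<bar>g' \<theta>\<bar> * b (g \<theta>) = 2 * pi * (exp (s * ln (sin (pi * \<theta>))) * exp (t * ln (cos (pi * \<theta>))))"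
        using p unfolding b_def g_def c2 pw[OF p(1)] pw[OF p(2)] by (simp add: g'_def abs_mult)
      also have "\<dots> = (2 * pi * 2 powr (- s - t)) * f \<theta>"
        using p by (simp add: f_def lsin_def lcos_def abs_mult ln_mult powr_def flip: exp_add)
          (simp add: algebra_simps)
      finally show ?thesis .
    qed
    show "(\<lambda>\<theta>. \<bar>g' \<theta>\<bar> * b (g \<theta>)) absolutely_integrable_on {0<..<1/2} \<longleftrightarrow>
      (\<lambda>\<theta>. (2 * pi * 2 powr (- s - t)) * f \<theta>) absolutely_integrable_on {0<..<1/2}"
      by (rule set_integrable_cong) (use eq in auto)
    show "integral {0<..<1/2} (\<lambda>\<theta>. \<bar>g' \<theta>\<bar> * b (g \<theta>)) =
      integral {0<..<1/2} (\<lambda>\<theta>. (2 * pi * 2 powr (- s - t)) * f \<theta>)"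
      by (rule integral_cong) (use eq in auto)
  qed
  have *: "(\<lambda>\<theta>. (2 * pi * 2 powr (- s - t)) * f \<theta>) absolutely_integrable_on {0<..<1/2}"
    "integral {0<..<1/2} (\<lambda>\<theta>. (2 * pi * 2 powr (- s - t)) * f \<theta>) = pi * 2 powr (- s - t) * Zgamma s t"
    using cov eqs eqs' Beta_conv_Zgamma[OF st] by metis+
  \<comment> \<open>Absolute integrability refers to the completed measure \<open>lebesgue\<close>;
    Borel measurability of \<open>f\<close> moves it to \<open>lborel\<close>.\<close>
  have [measurable]: "f \<in> borel_measurable borel"
    unfolding f_def by measurable
  have "f absolutely_integrable_on {0<..<1/2}"
    using *(1) by (subst (asm) set_integrable_mult_right_iff) auto
  then show int: "set_integrable lborel {0<..<1/2} f"
    unfolding set_integrable_def by (subst (asm) integrable_completion) auto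
  then show "(LINT \<theta>:{0<..<1/2}|lborel. f \<theta>) = Zgamma s t / 2"
    using *(2) by (simp add: set_borel_integral_eq_integral)
qed

text \<open>The reflection of \<open>\<theta>\<close> to \<open>1 - \<theta>\<close> preserves the
  integrand and swaps the two halves of \<open>reg\<close>, so the integral is twice that over the
  first half.\<close>

lemma reg_integral_real:
  fixes s t :: real
  assumes st: "s > -1" "t > -1"
  shows "integrable lborel (\<lambda>\<theta>. indicator reg \<theta> * exp (s * lsin \<theta> + t * lcos \<theta>))"
    "(\<integral>\<theta>. indicator reg \<theta> * exp (s * lsin \<theta> + t * lcos \<theta>) \<partial>lborel) = Zgamma s t"
proof -
  define f where "f = (\<lambda>\<theta>. exp (s * lsin \<theta> + t * lcos \<theta>))"
  define u where "u = (\<lambda>\<theta>. indicator {0<..<1/2} \<theta> * f \<theta>)"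
  have u: "integrable lborel u" "integral\<^sup>L lborel u = Zgamma s t / 2"
    using half_integral[OF st] by (simp_all add: u_def f_def set_integrable_def set_lebesgue_integral_def)
  have u': "integrable lborel (\<lambda>\<theta>. u (1 - \<theta>))" "(\<integral>\<theta>. u (1 - \<theta>) \<partial>lborel) = Zgamma s t / 2"
    using lborel_integrable_real_affine[OF u(1), of "-1" 1] lborel_integral_real_affine[of "-1" u 1] u(2)
    by simp_all
  have "sin (pi - x) = sin x" "cos (pi - x) = - cos x" for x :: real
    by (simp_all add: sin_diff cos_diff)
  then have "f (1 - \<theta>) = f \<theta>" for \<theta>
    by (simp add: f_def lsin_def lcos_def right_diff_distrib)
  then have eq: "(\<lambda>\<theta>. indicator reg \<theta> * f \<theta>) = (\<lambda>\<theta>. u \<theta> + u (1 - \<theta>))"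
    by (auto simp: fun_eq_iff u_def reg_def indicator_def)
  show "integrable lborel (\<lambda>\<theta>. indicator reg \<theta> * exp (s * lsin \<theta> + t * lcos \<theta>))"
    "(\<integral>\<theta>. indicator reg \<theta> * exp (s * lsin \<theta> + t * lcos \<theta>) \<partial>lborel) = Zgamma s t"
    using eq u u' by (simp_all add: f_def)
qed

subsection \<open>Analytic continuation\<close>

text \<open>The identity theorem on a connected half plane: the real ray on which the functions
  agree accumulates at 0.\<close>

lemma half_plane_identity:
  assumes "f holomorphic_on {z. Re z > -1}" "g holomorphic_on {z. Re z > -1}"
    and eq: "\<And>x::real. x > -1 \<Longrightarrow> f (of_real x) = g (of_real x)"
    and z: "Re z > -1"
  shows "f z = g z"
proof -
  have "f z - g z = 0"
  proof (rule analytic_continuation[where f = "\<lambda>z. f z - g z" and U = "complex_of_real ` {-1<..}" and \<xi> = 0])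
    show "(\<lambda>z. f z - g z) holomorphic_on {z. Re z > -1}"
      by (intro holomorphic_intros assms)
    show "open {z. Re z > -1}"
      by (rule open_halfspace_Re_gt)
    show "connected {z. Re z > -1}"
      by (intro convex_connected convex_halfspace_Re_gt)
    show "0 islimpt complex_of_real ` {-1<..}"
    proof (subst islimpt_approachable, intro allI impI)
      fix e :: real assume "e > 0"
      then show "\<exists>x'\<in>complex_of_real ` {-1<..}. x' \<noteq> 0 \<and> dist x' 0 < e"
        by (intro bexI[of _ "complex_of_real (e / 2)"] imageI) auto
    qed
  qed (use eq z in auto)
  then show ?thesis by simp
qed

lemma not_nonpos_Int_Re: "Re z > 0 \<Longrightarrow> z \<notin> \<int>\<^sub>\<le>\<^sub>0"
  by (auto elim!: nonpos_Ints_cases)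

lemma Gamma_nonzero_Re: "Re z > 0 \<Longrightarrow> Gamma z \<noteq> 0"
  using not_nonpos_Int_Re Gamma_eq_zero_iff by blast

lemma Zgamma_commute: "Zgamma s t = Zgamma t s"
  by (simp add: Zgamma_def mult.commute add.commute)

lemma Zgamma_holomorphic:
  fixes s :: complex
  assumes "Re s > -1"
  shows "(\<lambda>t. Zgamma s t) holomorphic_on {z. Re z > -1}" "(\<lambda>t. Zgamma t s) holomorphic_on {z. Re z > -1}"
proof -
  have *: "Re ((s + t) / 2 + 1) > 0" if "Re t > -1" for t
    using that assms by (simp add: field_simps)
  show "(\<lambda>t. Zgamma s t) holomorphic_on {z. Re z > -1}"
    unfolding Zgamma_def
    by (intro holomorphic_intros; use assms * in \<open>simp add: not_nonpos_Int_Re Gamma_nonzero_Re\<close>)+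
  then show "(\<lambda>t. Zgamma t s) holomorphic_on {z. Re z > -1}"
    by (simp add: Zgamma_commute)
qed

lemma Zgamma_of_real: "Zgamma (of_real s) (of_real t) = complex_of_real (Zgamma s t)"
proof -
  have "complex_of_real s + 1 = of_real (s + 1)" "complex_of_real t + 1 = of_real (t + 1)"
    "complex_of_real s / 2 + 1 = of_real (s / 2 + 1)" "complex_of_real t / 2 + 1 = of_real (t / 2 + 1)"
    "(complex_of_real s + complex_of_real t) / 2 + 1 = of_real ((s + t) / 2 + 1)"
    by simp_all
  then show ?thesis
    by (simp only: Zgamma_def Gamma_complex_of_real of_real_mult of_real_divide)
qed

lemma reg_integrable:
  assumes "Re s > -1" "Re t > -1"
  shows "integrable lborel (\<lambda>\<theta>. indicator reg \<theta> * exp (s * complex_of_real (lsin \<theta>) + t * complex_of_real (lcos \<theta>)))"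
  by (rule Bochner_Integration.integrable_bound[OF reg_integral_real(1)[OF assms]])
     (auto simp: norm_mult indicator_def)

text \<open>Continuation in one variable at a time: first \<open>t\<close> becomes complex while
  \<open>s\<close> is real, then \<open>s\<close> becomes complex while the complex \<open>t\<close>
  is fixed. Each time the exponential in the fixed variable serves as the weight in
  \<open>exp_integral_holomorphic\<close>.\<close>

lemma reg_integral:
  assumes "Re s > -1" "Re t > -1"
  shows "(\<integral>\<theta>. indicator reg \<theta> * exp (s * complex_of_real (lsin \<theta>) + t * complex_of_real (lcos \<theta>)) \<partial>lborel)
    = Zgamma s t"
proof -
  let ?F = "\<lambda>s t. \<integral>\<theta>. indicator reg \<theta> * exp (s * complex_of_real (lsin \<theta>) + t * complex_of_real (lcos \<theta>)) \<partial>lborel"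
  have real: "?F (of_real a) (of_real b) = Zgamma (of_real a) (of_real b)" if "a > -1" "b > -1" for a b :: real
  proof -
    have *: "(\<lambda>\<theta>. indicator reg \<theta> * exp (complex_of_real a * complex_of_real (lsin \<theta>) + of_real b * complex_of_real (lcos \<theta>))) =
        (\<lambda>\<theta>. complex_of_real (indicator reg \<theta> * exp (a * lsin \<theta> + b * lcos \<theta>)))"
      by (auto simp: fun_eq_iff indicator_def simp flip: exp_of_real)
    show ?thesis
      unfolding * integral_complex_of_real reg_integral_real(2)[OF that] Zgamma_of_real ..
  qed
  have eq1: "(\<lambda>t. ?F s t) = (\<lambda>t. \<integral>\<theta>. (indicator reg \<theta> * exp (s * complex_of_real (lsin \<theta>))) * exp (t * complex_of_real (lcos \<theta>)) \<partial>lborel)" for s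
    by (simp add: exp_add mult.assoc)
  have eq2: "(\<lambda>s. ?F s t) = (\<lambda>s. \<integral>\<theta>. (indicator reg \<theta> * exp (t * complex_of_real (lcos \<theta>))) * exp (s * complex_of_real (lsin \<theta>)) \<partial>lborel)" for t
    by (simp add: exp_add mult_ac)
  have norm: "norm (indicator reg \<theta> * exp z :: complex) = indicator reg \<theta> * exp (Re z)" for \<theta> z
    by (simp add: norm_mult indicator_def)
  have hol1: "(\<lambda>t. ?F s t) holomorphic_on {t. Re t > -1}" if "Re s > -1" for s
    unfolding eq1
  proof (rule exp_integral_holomorphic)
    show "integrable lborel (\<lambda>\<theta>. norm (indicator reg \<theta> * exp (s * complex_of_real (lsin \<theta>))) * exp (\<sigma> * lcos \<theta>))"
      if "\<sigma> > -1" for \<sigma>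
      using reg_integral_real(1)[OF \<open>Re s > -1\<close> that] by (simp add: norm exp_add mult.assoc)
  qed measurable
  have hol2: "(\<lambda>s. ?F s t) holomorphic_on {s. Re s > -1}" if "Re t > -1" for t
    unfolding eq2
  proof (rule exp_integral_holomorphic)
    show "integrable lborel (\<lambda>\<theta>. norm (indicator reg \<theta> * exp (t * complex_of_real (lcos \<theta>))) * exp (\<sigma> * lsin \<theta>))"
      if "\<sigma> > -1" for \<sigma>
      using reg_integral_real(1)[OF that \<open>Re t > -1\<close>] by (simp add: norm exp_add mult_ac)
  qed measurable
  have *: "?F (of_real a) t = Zgamma (of_real a) t" if "a > -1" for a :: real
  proof (rule half_plane_identity[where f = "\<lambda>t. ?F (of_real a) t" and g = "\<lambda>t. Zgamma (of_real a) t"])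
    show "(\<lambda>t. ?F (of_real a) t) holomorphic_on {z. Re z > -1}"
      by (rule hol1) (use that in simp)
    show "(\<lambda>t. Zgamma (complex_of_real a) t) holomorphic_on {z. Re z > -1}"
      by (rule Zgamma_holomorphic) (use that in simp)
  qed (use assms real[OF that] in blast)+
  show ?thesis
    by (rule half_plane_identity[where f = "\<lambda>s. ?F s t" and g = "\<lambda>s. Zgamma s t"])
       (fact hol2[OF assms(2)] Zgamma_holomorphic(2)[OF assms(2)] * assms(1))+
qed

section \<open>From the regular points to the whole unit interval\<close>

text \<open>\<open>reg\<close> omits only 0, 1/2 and 1 from the unit interval, a negligible set, so
  the values of the powers and logarithms at zeros of the sine or cosine do not matter.\<close>

lemma has_integral_reg:
  fixes f g :: "real \<Rightarrow> 'b :: euclidean_space"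
  assumes int: "set_integrable lborel reg f" and eq: "\<And>\<theta>. \<theta> \<in> reg \<Longrightarrow> g \<theta> = f \<theta>"
  shows "(g has_integral (LINT \<theta>:reg|lborel. f \<theta>)) {0..1}"
proof -
  have "(f has_integral (LINT \<theta>:reg|lborel. f \<theta>)) reg"
    using set_borel_integral_eq_integral[OF int] by (simp add: has_integral_iff)
  then have "(g has_integral (LINT \<theta>:reg|lborel. f \<theta>)) reg"
    by (rule has_integral_eq[rotated]) (simp add: eq)
  also have "?this \<longleftrightarrow> (g has_integral (LINT \<theta>:reg|lborel. f \<theta>)) {0..1}"
  proof (rule has_integral_spike_set_eq)
    show "negligible {x \<in> reg - {0..1}. g x \<noteq> 0}"
      by (rule negligible_subset[of "{}"]) (auto simp: reg_def)
    show "negligible {x \<in> {0..1} - reg. g x \<noteq> 0}"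
      by (rule negligible_subset[of "{0, 1/2, 1}"]) (auto simp: reg_def)
  qed
  finally show ?thesis .
qed

lemma sin_cos_nonzero_reg:
  assumes "\<theta> \<in> reg"
  shows "sin (pi * \<theta>) \<noteq> 0" "cos (pi * \<theta>) \<noteq> 0"
proof -
  have \<theta>: "0 < \<theta>" "\<theta> < 1" "\<theta> \<noteq> 1/2"
    using assms by (auto simp: reg_def)
  then show "sin (pi * \<theta>) \<noteq> 0"
    using sin_gt_zero[of "pi * \<theta>"] by simp
  show "cos (pi * \<theta>) \<noteq> 0"
  proof
    assume "cos (pi * \<theta>) = 0"
    then have "cos (pi * \<theta>) = cos (pi / 2)"
      by simp
    then have "pi * \<theta> = pi / 2"
      by (rule cos_inj_pi[rotated -1]) (use \<theta> in \<open>auto simp: field_simps\<close>)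
    then show False
      using \<theta> by simp
  qed
qed

lemma Zint_reg:
  assumes "\<theta> \<in> reg"
  shows "Zint s t \<theta> = exp (s * complex_of_real (lsin \<theta>) + t * complex_of_real (lcos \<theta>))"
  using sin_cos_nonzero_reg[OF assms]
  by (simp add: Zint_def powr_def lsin_def lcos_def Ln_of_real exp_add)

lemma Zint_has_integral:
  assumes "Re s > -1" "Re t > -1"
  shows "(Zint s t has_integral Zgamma s t) {0..1}"
proof -
  let ?f = "\<lambda>\<theta>. exp (s * complex_of_real (lsin \<theta>) + t * complex_of_real (lcos \<theta>))"
  have *: "(\<lambda>\<theta>. indicator reg \<theta> *\<^sub>R ?f \<theta>) = (\<lambda>\<theta>. indicator reg \<theta> * ?f \<theta>)"
    by (auto simp: indicator_def)
  have "(Zint s t has_integral (LINT \<theta>:reg|lborel. ?f \<theta>)) {0..1}"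
    by (rule has_integral_reg) (auto simp: set_integrable_def * reg_integrable[OF assms] Zint_reg)
  then show ?thesis
    using reg_integral[OF assms] by (simp add: set_lebesgue_integral_def *)
qed

subsection \<open>The infinite product and its logarithm\<close>

text \<open>The partial product is a rising factorial divided by a factorial, hence Gauss's
  approximation to \<open>1 / Gamma (z + 1)\<close>, up to the power of \<open>n\<close> with
  exponent \<open>z\<close> and a factor tending to 1.\<close>

lemma prod_one_plus_conv_rGamma_series:
  fixes z :: complex
  assumes "n > 0"
  shows "(\<Prod>k\<le>n. 1 + z / of_nat (Suc k)) =
    rGamma_series (z + 1) n * exp (z * of_real (ln (of_nat n))) * (of_nat n / of_nat (Suc n))"
proof -
  have "(\<Prod>k\<le>n. 1 + z / of_nat (Suc k)) = (\<Prod>k\<le>n. (z + 1 + of_nat k) / of_nat (Suc k))"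
    by (intro prod.cong) (auto simp: field_simps simp del: of_nat_Suc, simp add: algebra_simps)
  also have "\<dots> = pochhammer (z + 1) (Suc n) / (\<Prod>k\<le>n. of_nat (Suc k))"
    by (simp add: prod_dividef pochhammer_Suc_prod atLeast0AtMost)
  also have "(\<Prod>k\<le>n. of_nat (Suc k) :: complex) = fact n * of_nat (Suc n)"
    by (induction n) (auto simp: algebra_simps)
  finally show ?thesis
    using assms by (simp add: rGamma_series_def exp_add distrib_right exp_of_real field_simps del: of_nat_Suc)
qed

definition Zfactor :: "complex \<Rightarrow> complex \<Rightarrow> nat \<Rightarrow> complex" where
  "Zfactor s t n = (let m = of_nat (Suc n) :: complex in
           ((1 + s / (2 * m)) * (1 + t / (2 * m)) * (1 + (s + t) / (2 * m))) /
           ((1 + s / m) * (1 + t / m)))"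

text \<open>The powers of \<open>n\<close> cancel because
  \<open>s / 2 + t / 2 + (s + t) / 2 = s + t\<close>. Three correction factors in the numerator
  against two in the denominator leave a single \<open>n / (n + 1)\<close>, whose limit is
  1.\<close>

lemma prod_Zfactor_LIMSEQ:
  assumes "Re s > -1" "Re t > -1"
  shows "(\<lambda>n. \<Prod>k\<le>n. Zfactor s t k) \<longlonglongrightarrow> Zgamma s t"
proof -
  let ?R = "\<lambda>z n. rGamma_series (z + 1) n :: complex"
  let ?P = "\<lambda>z n. \<Prod>k\<le>n. 1 + z / of_nat (Suc k) :: complex"
  let ?g = "\<lambda>n. ?R (s / 2) n * ?R (t / 2) n * ?R ((s + t) / 2) n / (?R s n * ?R t n) * (of_nat n / of_nat (Suc n))"
  have "?g \<longlonglongrightarrow> rGamma (s / 2 + 1) * rGamma (t / 2 + 1) * rGamma ((s + t) / 2 + 1) / (rGamma (s + 1) * rGamma (t + 1)) * 1"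
    using assms by (intro tendsto_intros LIMSEQ_n_over_Suc_n)
       (auto simp: rGamma_eq_zero_iff not_nonpos_Int_Re)
  also have "rGamma (s / 2 + 1) * rGamma (t / 2 + 1) * rGamma ((s + t) / 2 + 1) / (rGamma (s + 1) * rGamma (t + 1)) * 1 = Zgamma s t"
    by (simp add: Zgamma_def Gamma_def field_simps)
  finally have lim: "?g \<longlonglongrightarrow> Zgamma s t" .
  have "eventually (\<lambda>n. ?g n = (\<Prod>k\<le>n. Zfactor s t k)) sequentially"
    using eventually_gt_at_top[of 0]
  proof eventually_elim
    case (elim n)
    let ?E = "\<lambda>z. exp (z * complex_of_real (ln (real n)))"
    have E: "?E (s / 2) * ?E (t / 2) * ?E ((s + t) / 2) = ?E s * ?E t"
      by (simp add: algebra_simps add_divide_distrib flip: exp_add)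
    have cancel: "(a1 * e1 * q) * (a2 * e2 * q) * (a3 * e3 * q) / ((a4 * e4 * q) * (a5 * e5 * q)) =
        a1 * a2 * a3 / (a4 * a5) * (e1 * e2 * e3 / (e4 * e5)) * q"
      if "q \<noteq> 0" for a1 a2 a3 a4 a5 e1 e2 e3 e4 e5 q :: complex
      using that by (simp add: mult_ac)
    have "(\<Prod>k\<le>n. Zfactor s t k) = ?P (s / 2) n * ?P (t / 2) n * ?P ((s + t) / 2) n / (?P s n * ?P t n)"
      unfolding Zfactor_def Let_def prod_dividef prod.distrib by (simp add: field_simps del: of_nat_Suc)
    also have "\<dots> = ?R (s / 2) n * ?R (t / 2) n * ?R ((s + t) / 2) n / (?R s n * ?R t n) *
        ((?E (s / 2) * ?E (t / 2) * ?E ((s + t) / 2)) / (?E s * ?E t)) * (of_nat n / of_nat (Suc n))"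
      unfolding prod_one_plus_conv_rGamma_series[OF elim] by (rule cancel) (use elim in \<open>simp del: of_nat_Suc\<close>)
    also have "\<dots> = ?g n"
      unfolding E by simp
    finally show ?case ..
  qed
  with lim show ?thesis
    by (rule Lim_transform_eventually)
qed

text \<open>Convergence of partial products amounts to \<open>has_prod\<close> only when the limit
  is nonzero.\<close>

lemma Zgamma_nonzero:
  fixes s t :: complex
  assumes "Re s > -1" "Re t > -1"
  shows "Zgamma s t \<noteq> 0"
proof -
  have "Re ((s + t) / 2 + 1) > 0"
    using assms by (simp add: field_simps)
  then show ?thesis
    using assms by (simp add: Zgamma_def Gamma_nonzero_Re)
qed

lemma Zfactor_has_prod:
  assumes "Re s > -1" "Re t > -1"
  shows "Zfactor s t has_prod Zgamma s t"
  using prod_Zfactor_LIMSEQ[OF assms] Zgamma_nonzero[OF assms]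
  by (simp add: has_prod_def raw_has_prod_def)

text \<open>The degree-\<open>k\<close> term of the exponent in part (ii), without the factor \<open>\<zeta> k\<close>; it vanishes for \<open>k = 1\<close>
  (and for \<open>k = 0\<close>, because \<open>1 / 0 = 0\<close>).\<close>
definition logcoeff :: "complex \<Rightarrow> complex \<Rightarrow> nat \<Rightarrow> complex" where
  "logcoeff s t k = (- 1) ^ k / of_nat k * ((1 - 1 / 2 ^ k) * (s ^ k + t ^ k) - (1 / 2 ^ k) * (s + t) ^ k)"

text \<open>With \<open>(s + t) / 2\<close> also bounded by 1/2, each of the three powers
  contributes at most \<open>(1 / 2) ^ k\<close>. This geometric decay makes the double series of
  logarithms absolutely convergent.\<close>

lemma norm_logcoeff_le:
  assumes st: "norm s \<le> 1/2" "norm t \<le> 1/2" and k: "k > 0"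
  shows "norm (logcoeff s t k) \<le> 3 * (1 / 2) ^ k"
proof -
  have "norm (logcoeff s t k) = norm ((1 - 1 / 2 ^ k) * (s ^ k + t ^ k) - ((s + t) / 2) ^ k) / real k"
    by (simp add: logcoeff_def norm_mult norm_divide norm_power power_divide)
  also have "\<dots> \<le> norm ((1 - 1 / 2 ^ k) * (s ^ k + t ^ k) - ((s + t) / 2) ^ k) / 1"
    using k by (intro divide_left_mono) auto
  also have "\<dots> \<le> norm (1 - 1 / 2 ^ k :: complex) * (norm s ^ k + norm t ^ k) + norm ((s + t) / 2) ^ k"
    by (auto simp: norm_mult norm_power intro!: order.trans[OF norm_triangle_ineq4] add_mono mult_mono
        order.trans[OF norm_triangle_ineq])
  also have "\<dots> \<le> 1 * ((1 / 2) ^ k + (1 / 2) ^ k) + (1 / 2) ^ k"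
  proof (intro add_mono mult_mono power_mono)
    have "(1 - 1 / 2 ^ k :: complex) = of_real (1 - 1 / 2 ^ k)"
      by simp
    also have "norm \<dots> = \<bar>1 - 1 / 2 ^ k\<bar>"
      by (rule norm_of_real)
    also have "\<dots> \<le> 1"
      by simp
    finally show "norm (1 - 1 / 2 ^ k :: complex) \<le> 1" .
    show "norm ((s + t) / 2) \<le> 1 / 2"
      using norm_triangle_ineq[of s t] st by (simp add: norm_divide)
  qed (use st in auto)
  finally show ?thesis by simp
qed

text \<open>The logarithm series of the five linear factors are combined with their signs. Only
  \<open>exp l\<close> is asserted, so the branch of the logarithm of the product is
  immaterial.\<close>

lemma Zfactor_log_sums:
  assumes st: "norm s \<le> 1/2" "norm t \<le> 1/2"
  obtains l where "(\<lambda>j. logcoeff s t (j + 2) / of_nat (Suc n) ^ (j + 2)) sums l" "exp l = Zfactor s t n"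
proof -
  define m :: complex where "m = of_nat (Suc n)"
  have m: "norm m \<ge> 1" "m \<noteq> 0"
    unfolding m_def norm_of_nat by (auto simp del: of_nat_Suc)
  define L where "L = (\<lambda>z::complex. ln (1 + z / m))"
  have small: "norm (z / m) < 1" if "norm z \<le> 1/2" for z
  proof -
    have "norm (z / m) \<le> norm z / 1"
      unfolding norm_divide using m by (intro divide_left_mono) auto
    with that show ?thesis by simp
  qed
  have L: "(\<lambda>k. - ((- (z / m)) ^ k) / of_nat k) sums L z" "exp (L z) = 1 + z / m" "1 + z / m \<noteq> 0"
    if "norm z \<le> 1/2" for z
  proof -
    show "(\<lambda>k. - ((- (z / m)) ^ k) / of_nat k) sums L z"
      unfolding L_def by (rule Ln_series'[OF small[OF that]])
    show "1 + z / m \<noteq> 0"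
      using small[OF that] by (metis add_eq_0_iff norm_minus_cancel norm_one order_less_irrefl)
    then show "exp (L z) = 1 + z / m"
      by (simp add: L_def)
  qed
  have half: "norm (s / 2) \<le> 1/2" "norm (t / 2) \<le> 1/2" "norm ((s + t) / 2) \<le> 1/2"
    using st norm_triangle_ineq[of s t] by (auto simp: norm_divide)
  let ?l = "L (s / 2) + L (t / 2) + L ((s + t) / 2) - L s - L t"
  let ?f = "\<lambda>z k. - ((- (z / m)) ^ k) / of_nat k"
  have "(\<lambda>k. ?f (s / 2) k + ?f (t / 2) k + ?f ((s + t) / 2) k - ?f s k - ?f t k) sums ?l"
    by (intro sums_add sums_diff L half st)
  also have "(\<lambda>k. ?f (s / 2) k + ?f (t / 2) k + ?f ((s + t) / 2) k - ?f s k - ?f t k) =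
      (\<lambda>k. logcoeff s t k / m ^ k)"
  proof
    fix k
    have f: "?f z k = - ((-1) ^ k * z ^ k / (of_nat k * m ^ k))" for z
      by (simp add: power_minus[of "z / m"] power_divide mult.commute)
    have g: "(z / 2) ^ k = 1 / 2 ^ k * z ^ k" for z :: complex
      by (simp add: power_divide)
    show "?f (s / 2) k + ?f (t / 2) k + ?f ((s + t) / 2) k - ?f s k - ?f t k = logcoeff s t k / m ^ k"
    proof (cases "k = 0")
      case False
      define u v A B C where "u = (-1 :: complex) ^ k" "v = 1 / (2 :: complex) ^ k" "A = s ^ k" "B = t ^ k" "C = (s + t) ^ k"
      have "of_nat k \<noteq> (0 :: complex)" "m ^ k \<noteq> 0"
        using False m by auto
      then show ?thesis
        unfolding f g logcoeff_def u_v_A_B_C_def[symmetric]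
        by (simp add: divide_simps) (simp add: algebra_simps)
    qed (simp add: logcoeff_def)
  qed
  finally have "(\<lambda>k. logcoeff s t k / m ^ k) sums ?l" .
  \<comment> \<open>The shift by 2 is harmless because the terms of degree 0 and 1 vanish; in degree
    1 both parts equal \<open>(s + t) / 2\<close>.\<close>
  then have "(\<lambda>j. logcoeff s t (j + 2) / m ^ (j + 2)) sums ?l"
    by (subst sums_iff_shift) (simp add: logcoeff_def numeral_2_eq_2)
  moreover have "exp ?l = Zfactor s t n"
    unfolding Zfactor_def Let_def m_def[symmetric]
    unfolding exp_add exp_diff L(2)[OF half(1)] L(2)[OF half(2)] L(2)[OF half(3)] L(2)[OF st(1)] L(2)[OF st(2)]
    by simp
  ultimately show ?thesis
    using that by (simp only: m_def)
qed

lemma rzeta_sums: "k \<ge> 2 \<Longrightarrow> (\<lambda>n. 1 / real (Suc n) ^ k) sums rzeta k"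
  unfolding rzeta_def
proof (rule summable_sums)
  assume "k \<ge> 2"
  then have "summable (\<lambda>n. inverse (real n ^ k))"
    by (rule inverse_power_summable)
  then have "summable (\<lambda>n. inverse (real (Suc n) ^ k))"
    by (subst summable_Suc_iff)
  then show "summable (\<lambda>n. 1 / real (Suc n) ^ k)"
    by (simp only: inverse_eq_divide)
qed

lemma rzeta_has_sum: "k \<ge> 2 \<Longrightarrow> ((\<lambda>n. 1 / real (Suc n) ^ k) has_sum rzeta k) UNIV"
  by (rule sums_nonneg_imp_has_sum[OF rzeta_sums]) auto

text \<open>An absolutely convergent double series is summed in two ways: rows give a logarithm of
  each factor of the product, columns give \<open>logcoeff\<close> times a zeta value.\<close>

lemma Zgamma_exp:
  assumes st: "norm s \<le> 1/2" "norm t \<le> 1/2"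
  obtains L where "(\<lambda>j. logcoeff s t (j + 2) * of_real (rzeta (j + 2))) sums L" "Zgamma s t = exp L"
proof -
  define f where "f = (\<lambda>(n, j). logcoeff s t (j + 2) / of_nat (Suc n) ^ (j + 2))"
  \<comment> \<open>A majorant that separates the indices: as the exponent \<open>j + 2\<close> is
    at least 2, the power of \<open>Suc n\<close> is bounded by its square, and
    \<open>norm_logcoeff_le\<close> supplies the geometric factor.\<close>
  define b where "b = (\<lambda>(n, j). 1 / real (Suc n) ^ 2 * (3 * (1 / 2) ^ j) :: real)"
  have bound: "norm (f (n, j)) \<le> b (n, j)" for n j
  proof -
    have "norm (f (n, j)) = norm (logcoeff s t (j + 2)) * (1 / real (Suc n) ^ (j + 2))"
      by (simp add: f_def norm_divide norm_power norm_mult del: of_nat_Suc)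
    also have "\<dots> \<le> (3 * (1 / 2) ^ j) * (1 / real (Suc n) ^ 2)"
    proof (intro mult_mono)
      show "norm (logcoeff s t (j + 2)) \<le> 3 * (1 / 2) ^ j"
        by (rule order.trans[OF norm_logcoeff_le[OF st]]) (auto intro: power_decreasing)
      show "1 / real (Suc n) ^ (j + 2) \<le> 1 / real (Suc n) ^ 2"
        by (intro divide_left_mono power_increasing) auto
    qed auto
    finally show ?thesis
      by (simp add: b_def mult.commute)
  qed
  have geo: "((\<lambda>j. 3 * (1 / 2) ^ j :: real) has_sum 6) UNIV"
    by (rule sums_nonneg_imp_has_sum) (use sums_mult[OF geometric_sums[of "1/2 :: real"], of 3] in auto)
  have row_b: "((\<lambda>j. b (n, j)) has_sum 1 / real (Suc n) ^ 2 * 6) UNIV" for n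
    unfolding b_def prod.case by (rule has_sum_cmult_right[OF geo])
  have "b summable_on UNIV \<times> UNIV"
  proof (rule summable_on_SigmaI)
    show "((\<lambda>j. b (n, j)) has_sum 1 / real (Suc n) ^ 2 * 6) UNIV" for n
      by (rule row_b)
    have "((\<lambda>n. 1 / real (Suc n) ^ 2) has_sum rzeta 2) UNIV"
      by (rule rzeta_has_sum) simp
    from has_sum_cmult_left[OF this, of 6] show "(\<lambda>n. 1 / real (Suc n) ^ 2 * 6) summable_on UNIV"
      by (auto simp: summable_on_def)
  qed (auto simp: b_def)
  then have "(\<lambda>p. norm (f p)) summable_on UNIV \<times> UNIV"
    by (rule summable_on_comparison_test) (use bound in auto)
  then have "f summable_on UNIV \<times> UNIV"
    by (rule abs_summable_summable)
  then obtain L where L: "(f has_sum L) (UNIV \<times> UNIV)"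
    by (auto simp: summable_on_def)
  have "\<exists>l. (\<lambda>j. f (n, j)) sums l \<and> exp l = Zfactor s t n" for n
    by (rule Zfactor_log_sums[OF st, of n]) (auto simp: f_def)
  then obtain l where l: "\<And>n. (\<lambda>j. f (n, j)) sums l n" "\<And>n. exp (l n) = Zfactor s t n"
    by metis
  have "((\<lambda>j. f (n, j)) has_sum l n) UNIV" for n
  proof (rule norm_summable_imp_has_sum[OF _ l(1)])
    have "summable (\<lambda>j. b (n, j))"
      using row_b has_sum_imp_sums sums_summable by blast
    then show "summable (\<lambda>j. norm (f (n, j)))"
      by (rule summable_comparison_test') (use bound in auto)
  qed
  from has_sum_SigmaD[OF L this] have "l sums L"
    by (rule has_sum_imp_sums)
  \<comment> \<open>Exponentiating partial sums gives the partial products, whose limit is already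
    known to be \<open>Zgamma s t\<close>.\<close>
  then have "(\<lambda>n. \<Sum>k\<le>n. l k) \<longlonglongrightarrow> L"
    by (simp add: sums_def_le)
  then have "(\<lambda>n. exp (\<Sum>k\<le>n. l k)) \<longlonglongrightarrow> exp L"
    by (rule tendsto_exp)
  then have "(\<lambda>n. \<Prod>k\<le>n. Zfactor s t k) \<longlonglongrightarrow> exp L"
    by (simp add: exp_sum l)
  moreover have "Re s > -1" "Re t > -1"
    using st abs_Re_le_cmod[of s] abs_Re_le_cmod[of t] by linarith+
  ultimately have "Zgamma s t = exp L"
    using prod_Zfactor_LIMSEQ LIMSEQ_unique by blast
  \<comment> \<open>Now the columns: summation over \<open>n\<close> for fixed \<open>j\<close>
    produces \<open>rzeta (j + 2)\<close>.\<close>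
  moreover
  have "((\<lambda>n. f (n, j)) has_sum logcoeff s t (j + 2) * of_real (rzeta (j + 2))) UNIV" for j
  proof -
    have "((\<lambda>n. 1 / real (Suc n) ^ (j + 2)) has_sum rzeta (j + 2)) UNIV"
      by (rule rzeta_has_sum) simp
    then have "((\<lambda>n. complex_of_real (1 / real (Suc n) ^ (j + 2))) has_sum of_real (rzeta (j + 2))) UNIV"
      by (simp only: has_sum_of_real_iff)
    from has_sum_cmult_right[OF this, of "logcoeff s t (j + 2)"] show ?thesis
      by (simp add: f_def)
  qed
  then have "((\<lambda>j. logcoeff s t (j + 2) * of_real (rzeta (j + 2))) has_sum L) UNIV"
    by (intro has_sum_SigmaD[OF has_sum_swap[THEN iffD1, OF L]]) simp
  then have "(\<lambda>j. logcoeff s t (j + 2) * of_real (rzeta (j + 2))) sums L"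
    by (rule has_sum_imp_sums)
  ultimately show ?thesis
    using that by blast
qed

subsection \<open>Even zeta values\<close>

lemma zeta_ring_Rats [simp]: "x \<in> \<rat> \<Longrightarrow> x \<in> zeta_ring"
  by (rule zeta_ring.rat)

lemma fact_Rats [simp]: "fact n \<in> (\<rat> :: 'a :: field_char_0 set)"
  by (metis Rats_of_nat of_nat_fact)

lemma zeta_ring_uminus: "x \<in> zeta_ring \<Longrightarrow> - x \<in> zeta_ring"
  using zeta_ring.mult[OF zeta_ring.rat[of "-1"]] by simp

lemma zeta_ring_diff: "x \<in> zeta_ring \<Longrightarrow> y \<in> zeta_ring \<Longrightarrow> x - y \<in> zeta_ring"
  using zeta_ring.add[OF _ zeta_ring_uminus[of y], of x] by simp

lemma zeta_ring_power: "x \<in> zeta_ring \<Longrightarrow> x ^ n \<in> zeta_ring"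
  by (induction n) (auto intro: zeta_ring.mult)

lemma zeta_ring_sum: "(\<And>i. i \<in> I \<Longrightarrow> f i \<in> zeta_ring) \<Longrightarrow> sum f I \<in> zeta_ring"
  by (induction I rule: infinite_finite_induct) (auto intro: zeta_ring.add)

lemma zeta_ring_divide: "x \<in> zeta_ring \<Longrightarrow> q \<in> \<rat> \<Longrightarrow> x / q \<in> zeta_ring"
  using zeta_ring.mult[OF _ zeta_ring.rat[of "inverse q"], of x] by (simp add: divide_inverse)

lemmas zeta_ring_intros = zeta_ring_uminus zeta_ring_diff zeta_ring_power zeta_ring_sum zeta_ring_divide
  zeta_ring.add zeta_ring.mult

text \<open>This is \<open>(exp P)' = P' * exp P\<close> read off coefficientwise.\<close>
lemma exp_power_series_recurrence:
  fixes p a :: "nat \<Rightarrow> real"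
  assumes r: "r > 0" and p0: "p 0 = 0"
    and sums: "\<And>u::complex. norm u < r \<Longrightarrow>
      \<exists>L. (\<lambda>n. of_real (p n) * u ^ n) sums L \<and> (\<lambda>n. of_real (a n) * u ^ n) sums exp L"
  shows "a 0 = 1"
    and "real (Suc n) * a (Suc n) = (\<Sum>k\<le>n. real (Suc k) * p (Suc k) * a (n - k))"
proof -
  define P where "P = Abs_fps (\<lambda>n. complex_of_real (p n))"
  define A where "A = Abs_fps (\<lambda>n. complex_of_real (a n))"
  define f where "f = (\<lambda>u. \<Sum>n. complex_of_real (p n) * u ^ n)"
  have f: "(\<lambda>n. of_real (p n) * u ^ n) sums f u" "(\<lambda>n. of_real (a n) * u ^ n) sums exp (f u)"
    if "norm u < r" for u
    using sums[OF that] by (auto simp: f_def sums_iff)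
  have ev: "eventually (\<lambda>u::complex. norm u < r) (nhds 0)"
    using eventually_nhds_ball[OF r, of "0 :: complex"] by simp
  have "f has_fps_expansion P"
    by (rule has_fps_expansionI) (use ev in \<open>eventually_elim, simp add: P_def f\<close>)
  then have "(exp \<circ> f) has_fps_expansion (fps_exp 1 oo P)"
    by (intro has_fps_expansion_compose has_fps_expansion_exp1) (simp_all add: P_def p0)
  moreover have "(exp \<circ> f) has_fps_expansion A"
    by (rule has_fps_expansionI) (use ev in \<open>eventually_elim, simp add: A_def f\<close>)
  \<comment> \<open>A function has only one power series expansion at 0, so the convergent
    hypothesis becomes an identity of formal power series.\<close>
  ultimately have A: "A = fps_exp 1 oo P"
    by (rule fps_expansion_unique_complex[symmetric])
  have "fps_nth A 0 = 1"
    unfolding A by simp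
  then show "a 0 = 1"
    by (simp add: A_def)
  have "fps_deriv A = fps_deriv P * A"
    unfolding A by (subst fps_compose_deriv) (simp_all add: P_def p0 mult.commute)
  then have "fps_nth (fps_deriv A) n = fps_nth (fps_deriv P * A) n"
    by simp
  then have "complex_of_real (real (Suc n) * a (Suc n)) =
      complex_of_real (\<Sum>k\<le>n. real (Suc k) * p (Suc k) * a (n - k))"
    by (simp add: A_def P_def fps_mult_nth atLeast0AtMost del: of_nat_Suc)
  then show "real (Suc n) * a (Suc n) = (\<Sum>k\<le>n. real (Suc k) * p (Suc k) * a (n - k))"
    by (simp only: of_real_eq_iff)
qed

text \<open>For \<open>t = - s\<close> the third Gamma factor in the denominator is
  \<open>Gamma 1 = 1\<close>. Reflection at \<open>s\<close> and at \<open>s / 2\<close> leaves a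
  quotient of sines, which the double angle formula simplifies.\<close>

lemma Zgamma_minus:
  fixes s :: complex
  assumes "norm s < 1"
  shows "cos (of_real pi * s / 2) * Zgamma s (- s) = 1"
proof (cases "s = 0")
  case True
  then show ?thesis by (simp add: Zgamma_def)
next
  case False
  have nonint: "z \<notin> \<int>\<^sub>\<le>\<^sub>0" if "norm z < 1" "z \<noteq> 0" for z :: complex
    using that by (auto elim!: nonpos_Ints_cases simp: norm_of_int simp flip: of_int_abs)
  have refl: "Gamma (z + 1) * Gamma (- z + 1) = of_real pi * z / sin (of_real pi * z)"
    "sin (of_real pi * z) \<noteq> 0" if z: "norm z < 1" "z \<noteq> 0" for z :: complex
  proof -
    have "Gamma (z + 1) = z * Gamma z"
      by (rule Gamma_plus1[OF nonint[OF z]])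
    then show "Gamma (z + 1) * Gamma (- z + 1) = of_real pi * z / sin (of_real pi * z)"
      using Gamma_reflection_complex[of z] by (simp add: mult.assoc)
    have "Re z < 1"
      using z complex_Re_le_cmod[of z] by linarith
    \<comment> \<open>If the sine were 0, division by zero would make the right-hand side of the
      reflection formula 0, but neither Gamma value vanishes.\<close>
    then have "Gamma z * Gamma (1 - z) \<noteq> 0"
      using nonint[OF z] not_nonpos_Int_Re[of "1 - z"] by (simp add: Gamma_eq_zero_iff)
    then show "sin (of_real pi * z) \<noteq> 0"
      unfolding Gamma_reflection_complex by auto
  qed
  have sin2: "sin (of_real pi * s) = 2 * sin (of_real pi * (s / 2)) * cos (of_real pi * s / 2)"
    using sin_double[of "of_real pi * (s / 2)"] by simp
  have "Zgamma s (- s) = (Gamma (s + 1) * Gamma (- s + 1)) / (Gamma (s / 2 + 1) * Gamma (- (s / 2) + 1))"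
    by (simp add: Zgamma_def)
  also have "\<dots> = (of_real pi * s / sin (of_real pi * s)) / (of_real pi * (s / 2) / sin (of_real pi * (s / 2)))"
    using assms False by (subst (1 2) refl(1)) (auto simp: norm_divide)
  also have "\<dots> = 2 * sin (of_real pi * (s / 2)) / sin (of_real pi * s)"
    using False by simp
  finally have "cos (of_real pi * s / 2) * Zgamma s (- s) =
      cos (of_real pi * s / 2) * (2 * sin (of_real pi * (s / 2)) / sin (of_real pi * s))"
    by simp
  also have "\<dots> = sin (of_real pi * s) / sin (of_real pi * s)"
    unfolding sin2 by simp
  finally show ?thesis
    using refl(2)[OF assms False] by simp
qed

lemma cos_coeff_mem: "cos_coeff n * (pi / 2) ^ n \<in> zeta_ring"
proof (cases "even n")
  case True
  then obtain k where n: "n = 2 * k" by blast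
  have "cos_coeff n * (pi / 2) ^ n = (- 1) ^ k / fact n * (pi\<^sup>2) ^ k / 2 ^ n"
    by (simp add: cos_coeff_def n power_divide power_mult)
  also have "\<dots> \<in> zeta_ring"
    by (intro zeta_ring_intros zeta_ring.pi2) auto
  finally show ?thesis .
qed (simp add: cos_coeff_def)

text \<open>Odd arguments are generators. For even ones, \<open>exp (- L) = cos (pi * u / 2)\<close>
  on the line \<open>t = - s\<close>; the cosine coefficients are rational multiples of powers of
  \<open>pi ^ 2\<close>, and the recurrence recovers the coefficients of \<open>- L\<close> from
  them.\<close>

lemma rzeta_mem:
  assumes k: "k \<ge> 2"
  shows "rzeta k \<in> zeta_ring"
proof (cases "even k")
  case False
  then obtain j where "k = 2 * j + 1" by (auto elim: oddE)
  with k zeta_ring.zodd[of j] show ?thesis by simp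
next
  case True
  \<comment> \<open>The coefficients of a logarithm of \<open>cos (pi * u / 2)\<close>: the negated
    exponent of \<open>Zgamma u (- u)\<close>, where the \<open>(s + t) ^ k\<close> term has
    disappeared. Odd \<open>k\<close> give 0.\<close>
  define p where "p = (\<lambda>k. if k < 2 then 0 else - ((- 1) ^ k / real k * ((1 - 1 / 2 ^ k) * (1 + (- 1) ^ k)) * rzeta k))"
  define a where "a = (\<lambda>n. cos_coeff n * (pi / 2) ^ n)"
  have a_mem: "a n \<in> zeta_ring" for n
    unfolding a_def by (rule cos_coeff_mem)
  have rec: "a 0 = 1" "real (Suc n) * a (Suc n) = (\<Sum>k\<le>n. real (Suc k) * p (Suc k) * a (n - k))" for n
  proof -
    have "\<exists>L. (\<lambda>n. of_real (p n) * u ^ n) sums L \<and> (\<lambda>n. of_real (a n) * u ^ n) sums exp L"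
      if u: "norm u < 1/2" for u :: complex
    proof -
      have "norm u \<le> 1/2" "norm (- u) \<le> 1/2"
        using u by auto
      then obtain L where L: "(\<lambda>j. logcoeff u (- u) (j + 2) * of_real (rzeta (j + 2))) sums L" "Zgamma u (- u) = exp L"
        by (rule Zgamma_exp)
      have "- (logcoeff u (- u) k * of_real (rzeta k)) = of_real (p k) * u ^ k" if "k \<ge> 2" for k
      proof -
        have "u ^ k + (- u) ^ k = (1 + (- 1) ^ k) * u ^ k"
          by (simp add: power_minus[of u] distrib_right)
        then have "logcoeff u (- u) k = of_real ((- 1) ^ k / real k * ((1 - 1 / 2 ^ k) * (1 + (- 1) ^ k))) * u ^ k"
          using that by (simp add: logcoeff_def)
        then show ?thesis
          using that by (simp add: p_def)
      qed
      with sums_minus[OF L(1)] have "(\<lambda>j. of_real (p (j + 2)) * u ^ (j + 2)) sums (- L)"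
        by simp
      then have "(\<lambda>n. of_real (p n) * u ^ n) sums (- L)"
        by (subst (asm) sums_iff_shift) (simp add: p_def numeral_2_eq_2)
      moreover have "exp (- L) = cos (of_real pi * u / 2)"
        using Zgamma_minus[of u] u L(2) by (simp add: exp_minus field_simps)
      moreover have "(\<lambda>n. of_real (a n) * u ^ n) sums cos (of_real pi * u / 2)"
        using cos_converges[of "of_real pi * u / 2"]
        by (simp add: a_def scaleR_conv_of_real power_mult_distrib power_divide mult_ac)
      ultimately show ?thesis by metis
    qed
    from exp_power_series_recurrence[of "1/2" p a, OF _ _ this] show "a 0 = 1"
      "real (Suc n) * a (Suc n) = (\<Sum>k\<le>n. real (Suc k) * p (Suc k) * a (n - k))" for n
      by (auto simp: p_def)
  qed
  have "p (Suc n) \<in> zeta_ring" for n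
  proof (induction n rule: less_induct)
    case (less n)
    \<comment> \<open>As \<open>a 0 = 1\<close>, the top summand is a rational multiple of
      \<open>p (Suc n)\<close>, and all other summands involve earlier values of
      \<open>p\<close>.\<close>
    have "(\<Sum>k\<le>n. real (Suc k) * p (Suc k) * a (n - k)) =
        (\<Sum>k<n. real (Suc k) * p (Suc k) * a (n - k)) + real (Suc n) * p (Suc n)"
      using rec(1) by (simp flip: lessThan_Suc_atMost)
    with rec(2)[of n] have "p (Suc n) = a (Suc n) - (\<Sum>k<n. real (Suc k) * p (Suc k) * a (n - k)) / real (Suc n)"
      by (simp add: field_simps del: of_nat_Suc)
    also have "\<dots> \<in> zeta_ring"
      using less by (intro zeta_ring_intros) (auto intro: a_mem simp del: of_nat_Suc)
    finally show ?case .
  qed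
  from this[of "k - 1"] have "p k \<in> zeta_ring"
    using k by (simp add: Suc_diff_Suc)
  moreover have "rzeta k = p k / (- 2 * (1 - 1 / 2 ^ k) / real k)"
  proof -
    have "1 < (2::real) ^ k"
      using k by (intro one_less_power) auto
    then have v: "1 - 1 / (2::real) ^ k \<noteq> 0"
      by simp
    have "p k = - (2 * (1 - 1 / 2 ^ k) / real k) * rzeta k"
      using k True by (simp add: p_def)
    moreover have "y = q / (- 2 * v / m)" if "q = - (2 * v / m) * y" "v \<noteq> 0" "m \<noteq> 0" for y q v m :: real
      using that by simp
    ultimately show ?thesis
      using k v by (metis of_nat_eq_0_iff not_numeral_le_zero)
  qed
  moreover have "- 2 * (1 - 1 / 2 ^ k) / real k \<in> \<rat>"
    by (intro Rats_divide Rats_mult Rats_diff Rats_power) auto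
  ultimately show ?thesis
    by (simp only: zeta_ring_divide)
qed

subsection \<open>Log-moments\<close>

definition zeta_poly :: "real poly \<Rightarrow> bool" where
  "zeta_poly P \<longleftrightarrow> (\<forall>i. coeff P i \<in> zeta_ring)"

lemma zeta_poly_add: "zeta_poly P \<Longrightarrow> zeta_poly Q \<Longrightarrow> zeta_poly (P + Q)"
  and zeta_poly_diff: "zeta_poly P \<Longrightarrow> zeta_poly Q \<Longrightarrow> zeta_poly (P - Q)"
  and zeta_poly_smult: "x \<in> zeta_ring \<Longrightarrow> zeta_poly P \<Longrightarrow> zeta_poly (smult x P)"
  and zeta_poly_mult: "zeta_poly P \<Longrightarrow> zeta_poly Q \<Longrightarrow> zeta_poly (P * Q)"
  and zeta_poly_1: "zeta_poly 1"
  and zeta_poly_monom: "x \<in> zeta_ring \<Longrightarrow> zeta_poly (monom x n)"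
  by (auto simp: zeta_poly_def coeff_mult intro!: zeta_ring_intros)

lemma zeta_poly_sum: "(\<And>i. i \<in> I \<Longrightarrow> zeta_poly (f i)) \<Longrightarrow> zeta_poly (sum f I)"
  by (auto simp: zeta_poly_def coeff_sum intro!: zeta_ring_intros)

lemma zeta_poly_power: "zeta_poly P \<Longrightarrow> zeta_poly (P ^ n)"
  by (induction n) (auto intro: zeta_poly_1 zeta_poly_mult)

section \<open>Moments as Taylor coefficients of the integral\<close>

definition moment :: "nat \<Rightarrow> nat \<Rightarrow> real" where
  "moment a b = (\<integral>\<theta>. indicator reg \<theta> * (lsin \<theta> ^ a * lcos \<theta> ^ b) \<partial>lborel)"

definition mcoeff :: "nat \<Rightarrow> nat \<Rightarrow> real" where
  "mcoeff a b = moment a b / (fact a * fact b)"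

text \<open>Resolving the two absolute values by sign gives four exponentials with real exponents
  \<open>r\<close> or \<open>- r\<close>, each integrable because \<open>- r > -1\<close>.\<close>

lemma exp_abs_integrable:
  assumes "0 \<le> r" "r < 1"
  shows "integrable lborel (\<lambda>\<theta>. indicator reg \<theta> * exp (r * (\<bar>lsin \<theta>\<bar> + \<bar>lcos \<theta>\<bar>)) :: real)"
proof (rule Bochner_Integration.integrable_bound)
  let ?e = "\<lambda>s t \<theta>. indicator reg \<theta> * exp (s * lsin \<theta> + t * lcos \<theta>) :: real"
  show "integrable lborel (\<lambda>\<theta>. ?e r r \<theta> + ?e r (- r) \<theta> + ?e (- r) r \<theta> + ?e (- r) (- r) \<theta>)"
    using assms by (intro Bochner_Integration.integrable_add reg_integral_real) auto
  show "AE \<theta> in lborel. norm (indicator reg \<theta> * exp (r * (\<bar>lsin \<theta>\<bar> + \<bar>lcos \<theta>\<bar>))) \<le>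
      norm (?e r r \<theta> + ?e r (- r) \<theta> + ?e (- r) r \<theta> + ?e (- r) (- r) \<theta>)"
  proof (rule AE_I2)
    fix \<theta>
    have "exp (r * (\<bar>lsin \<theta>\<bar> + \<bar>lcos \<theta>\<bar>)) \<in>
      {exp (r * lsin \<theta> + r * lcos \<theta>), exp (r * lsin \<theta> + - r * lcos \<theta>),
       exp (- r * lsin \<theta> + r * lcos \<theta>), exp (- r * lsin \<theta> + - r * lcos \<theta>)}"
      by (auto simp: abs_if distrib_left right_diff_distrib)
    then have "exp (r * (\<bar>lsin \<theta>\<bar> + \<bar>lcos \<theta>\<bar>)) \<le>
       exp (r * lsin \<theta> + r * lcos \<theta>) + exp (r * lsin \<theta> + - r * lcos \<theta>) +
       exp (- r * lsin \<theta> + r * lcos \<theta>) + exp (- r * lsin \<theta> + - r * lcos \<theta>)"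
      by (elim insertE emptyE) (simp_all add: add_nonneg_nonneg add_increasing add_increasing2)
    then show "norm (indicator reg \<theta> * exp (r * (\<bar>lsin \<theta>\<bar> + \<bar>lcos \<theta>\<bar>))) \<le>
      norm (?e r r \<theta> + ?e r (- r) \<theta> + ?e (- r) r \<theta> + ?e (- r) (- r) \<theta>)"
      by (cases "\<theta> \<in> reg") simp_all
  qed
qed measurable

text \<open>A single term of the exponential series bounds \<open>\<bar>x\<bar> ^ n\<close> by a
  constant times \<open>exp (\<bar>x\<bar> / 2)\<close>, so \<open>exp_abs_integrable\<close> with
  \<open>r = 1/2\<close> dominates.\<close>

lemma moment_integrable: "integrable lborel (\<lambda>\<theta>. indicator reg \<theta> * (lsin \<theta> ^ a * lcos \<theta> ^ b))"
proof (rule Bochner_Integration.integrable_bound)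
  have int: "integrable lborel (\<lambda>\<theta>. indicator reg \<theta> * exp (1/2 * (\<bar>lsin \<theta>\<bar> + \<bar>lcos \<theta>\<bar>)) :: real)"
    by (rule exp_abs_integrable) auto
  then show "integrable lborel (\<lambda>\<theta>. (fact a * 2 ^ a * (fact b * 2 ^ b)) *
      (indicator reg \<theta> * exp (1/2 * (\<bar>lsin \<theta>\<bar> + \<bar>lcos \<theta>\<bar>))) :: real)"
    by (rule integrable_mult_right)
  have pow: "\<bar>x\<bar> ^ n \<le> fact n * 2 ^ n * exp (1/2 * \<bar>x\<bar>)" for x :: real and n
  proof -
    have "(\<bar>x\<bar> / 2) ^ n / fact n \<le> exp (\<bar>x\<bar> / 2)"
      using has_sum_mono_neutral[of "\<lambda>k. (\<bar>x\<bar> / 2) ^ k / fact k" "{n}" "(\<bar>x\<bar> / 2) ^ n / fact n" "\<lambda>k. (\<bar>x\<bar> / 2) ^ k / fact k" UNIV "exp (\<bar>x\<bar> / 2)"]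
        has_sum_exp[of "\<bar>x\<bar> / 2"] by (auto simp: has_sum_finite_iff)
    then show ?thesis
      by (simp add: power_divide field_simps)
  qed
  show "AE \<theta> in lborel. norm (indicator reg \<theta> * (lsin \<theta> ^ a * lcos \<theta> ^ b)) \<le>
      norm ((fact a * 2 ^ a * (fact b * 2 ^ b)) *
      (indicator reg \<theta> * exp (1/2 * (\<bar>lsin \<theta>\<bar> + \<bar>lcos \<theta>\<bar>))) :: real)"
  proof (rule AE_I2)
    fix \<theta>
    have "\<bar>lsin \<theta>\<bar> ^ a * \<bar>lcos \<theta>\<bar> ^ b \<le>
        (fact a * 2 ^ a * exp (1/2 * \<bar>lsin \<theta>\<bar>)) * (fact b * 2 ^ b * exp (1/2 * \<bar>lcos \<theta>\<bar>))"
      by (intro mult_mono pow) auto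
    also have "\<dots> = fact a * 2 ^ a * (fact b * 2 ^ b) * exp (1/2 * (\<bar>lsin \<theta>\<bar> + \<bar>lcos \<theta>\<bar>))"
      by (simp add: distrib_left exp_add add_divide_distrib)
    finally show "norm (indicator reg \<theta> * (lsin \<theta> ^ a * lcos \<theta> ^ b)) \<le>
      norm ((fact a * 2 ^ a * (fact b * 2 ^ b)) *
      (indicator reg \<theta> * exp (1/2 * (\<bar>lsin \<theta>\<bar> + \<bar>lcos \<theta>\<bar>))) :: real)"
      by (cases "\<theta> \<in> reg") (simp_all add: abs_mult power_abs)
  qed
qed measurable

lemma mcoeff_has_sum:
  assumes "norm s \<le> 1/2" "norm t \<le> 1/2"
  shows "((\<lambda>(a, b). complex_of_real (mcoeff a b) * s ^ a * t ^ b) has_sum Zgamma s t) UNIV"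
proof -
  have Re: "Re s > -1" "Re t > -1"
    using assms abs_Re_le_cmod[of s] abs_Re_le_cmod[of t] by linarith+
  have norm: "norm (indicator reg \<theta> :: complex) = indicator reg \<theta>" for \<theta>
    by (simp add: indicator_def)
  have eq: "(\<integral>\<theta>. indicator reg \<theta> * complex_of_real (lsin \<theta> ^ a * lcos \<theta> ^ b) \<partial>lborel) = of_real (moment a b)" for a b
  proof -
    have "(\<lambda>\<theta>. indicator reg \<theta> * complex_of_real (lsin \<theta> ^ a * lcos \<theta> ^ b)) =
        (\<lambda>\<theta>. complex_of_real (indicator reg \<theta> * (lsin \<theta> ^ a * lcos \<theta> ^ b)))"
      by (auto simp: indicator_def)
    then show ?thesis
      by (simp only: integral_complex_of_real moment_def)
  qed
  have "((\<lambda>(a, b). (\<integral>\<theta>. indicator reg \<theta> * complex_of_real (lsin \<theta> ^ a * lcos \<theta> ^ b) \<partial>lborel) / (fact a * fact b) * s ^ a * t ^ b)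
      has_sum (\<integral>\<theta>. indicator reg \<theta> * exp (s * complex_of_real (lsin \<theta>) + t * complex_of_real (lcos \<theta>)) \<partial>lborel)) UNIV"
    by (rule exp_moments_has_sum[where r = "1/2"])
       (use assms exp_abs_integrable[of "1/2"] in \<open>simp_all add: norm\<close>)
  then show ?thesis
    unfolding reg_integral[OF Re] eq by (simp add: mcoeff_def)
qed

text \<open>The coefficient of \<open>u ^ n\<close> in the expansion at \<open>(s, t) = (x * u, u)\<close>, as a polynomial in \<open>x\<close>;
  \<open>lpoly\<close> plays the same role for the exponent.\<close>
definition hpoly :: "nat \<Rightarrow> real poly" where
  "hpoly n = (\<Sum>a\<le>n. monom (mcoeff a (n - a)) a)"

text \<open>The unordered double series may be regrouped by total degree \<open>n = a + b\<close>;
  on the line \<open>(x * u, u)\<close> every term of the group carries the same power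
  \<open>u ^ n\<close>.\<close>

lemma hpoly_sums:
  fixes u :: complex
  assumes u: "norm u \<le> 1/2" "norm (of_real x * u) \<le> 1/2"
  shows "(\<lambda>n. of_real (poly (hpoly n) x) * u ^ n) sums Zgamma (of_real x * u) u"
proof -
  let ?f = "\<lambda>(a, b). complex_of_real (mcoeff a b) * (of_real x * u) ^ a * u ^ b"
  have "(?f has_sum Zgamma (of_real x * u) u) UNIV"
    by (rule mcoeff_has_sum) (use u in auto)
  also have "?this \<longleftrightarrow> ((\<lambda>(n, a). ?f (a, n - a)) has_sum Zgamma (of_real x * u) u) (Sigma UNIV (\<lambda>n. {..n}))"
    by (rule has_sum_reindex_bij_witness[of _ "\<lambda>(n, a). (a, n - a)" "\<lambda>(a, b). (a + b, a)"]) auto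
  finally have "((\<lambda>n. \<Sum>a\<le>n. ?f (a, n - a)) has_sum Zgamma (of_real x * u) u) UNIV"
    by (rule has_sum_SigmaD) (simp add: has_sum_finite_iff)
  also have "(\<lambda>n. \<Sum>a\<le>n. ?f (a, n - a)) = (\<lambda>n. of_real (poly (hpoly n) x) * u ^ n)"
  proof
    fix n
    have "(\<Sum>a\<le>n. ?f (a, n - a)) = (\<Sum>a\<le>n. of_real (mcoeff a (n - a) * x ^ a) * (u ^ a * u ^ (n - a)))"
      by (simp add: power_mult_distrib mult_ac)
    also have "\<dots> = (\<Sum>a\<le>n. of_real (mcoeff a (n - a) * x ^ a) * u ^ n)"
      by (intro sum.cong) (auto simp flip: power_add)
    also have "\<dots> = of_real (poly (hpoly n) x) * u ^ n"
      by (simp add: hpoly_def poly_sum poly_monom sum_distrib_right)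
    finally show "(\<Sum>a\<le>n. ?f (a, n - a)) = of_real (poly (hpoly n) x) * u ^ n" .
  qed
  finally show ?thesis
    by (rule has_sum_imp_sums)
qed

definition lpoly :: "nat \<Rightarrow> real poly" where
  "lpoly k = (if k < 2 then 0 else
     smult ((- 1) ^ k / real k * rzeta k) (smult (1 - 1 / 2 ^ k) (monom 1 k + 1) - smult (1 / 2 ^ k) ((monom 1 1 + 1) ^ k)))"

lemma zeta_poly_lpoly: "zeta_poly (lpoly k)"
  unfolding lpoly_def
  by (auto intro!: zeta_poly_smult zeta_poly_diff zeta_poly_add zeta_poly_power zeta_poly_1 zeta_poly_monom
      zeta_ring_intros rzeta_mem simp: zeta_poly_def[of 0])

text \<open>\<open>logcoeff\<close> is homogeneous of degree \<open>k\<close>, so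
  \<open>u ^ k\<close> factors out.\<close>

lemma poly_lpoly:
  fixes u :: complex
  assumes "k \<ge> 2"
  shows "complex_of_real (poly (lpoly k) x) * u ^ k = logcoeff (of_real x * u) u k * of_real (rzeta k)"
proof -
  have "of_real x * u + u = (of_real x + 1) * u"
    by (simp add: distrib_right)
  then have *: "(of_real x * u + u) ^ k = (of_real x + 1) ^ k * u ^ k"
    by (simp only: power_mult_distrib)
  have "logcoeff (of_real x * u) u k =
      (- 1) ^ k / of_nat k * ((1 - 1 / 2 ^ k) * (of_real x ^ k + 1) - 1 / 2 ^ k * (of_real x + 1) ^ k) * u ^ k"
    unfolding logcoeff_def * power_mult_distrib
    by (simp add: ring_distribs mult_ac add_divide_distrib diff_divide_distrib)
  moreover have "poly (lpoly k) x =
      (- 1) ^ k / real k * rzeta k * ((1 - 1 / 2 ^ k) * (x ^ k + 1) - 1 / 2 ^ k * (x + 1) ^ k)"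
    using assms by (simp add: lpoly_def poly_monom)
  ultimately show ?thesis
    by simp
qed

text \<open>For each fixed real \<open>x\<close> this is the recurrence for exponentials of power
  series in \<open>u\<close>; since it holds at every \<open>x\<close>, it is an identity of
  polynomials.\<close>

lemma hpoly_recurrence:
  "hpoly 0 = 1"
  "smult (real (Suc n)) (hpoly (Suc n)) = (\<Sum>k\<le>n. smult (real (Suc k)) (lpoly (Suc k) * hpoly (n - k)))"
proof -
  have *: "poly (hpoly 0) x = 1"
    "real (Suc n) * poly (hpoly (Suc n)) x = (\<Sum>k\<le>n. real (Suc k) * poly (lpoly (Suc k)) x * poly (hpoly (n - k)) x)"
    for x and n
  proof -
    \<comment> \<open>Chosen so that \<open>norm u < r\<close> keeps both \<open>u\<close> and
      \<open>x * u\<close> within radius 1/2, where the two expansions are available.\<close>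
    define r where "r = 1 / (2 * (1 + \<bar>x\<bar>))"
    have r: "r > 0"
      by (simp add: r_def add_pos_nonneg)
    have "\<exists>L. (\<lambda>n. of_real (poly (lpoly n) x) * u ^ n) sums L \<and> (\<lambda>n. of_real (poly (hpoly n) x) * u ^ n) sums exp L"
      if u: "norm u < r" for u :: complex
    proof -
      have "(1 + \<bar>x\<bar>) * norm u \<le> 1/2"
        using u by (simp add: r_def field_simps)
      then have "norm u + \<bar>x\<bar> * norm u \<le> 1/2"
        by (simp add: distrib_right)
      moreover have "0 \<le> norm u" "0 \<le> \<bar>x\<bar> * norm u"
        by auto
      ultimately have small: "norm u \<le> 1/2" "norm (of_real x * u) \<le> 1/2"
        unfolding norm_mult norm_of_real by linarith+
      obtain L where L: "(\<lambda>j. logcoeff (of_real x * u) u (j + 2) * of_real (rzeta (j + 2))) sums L"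
        "Zgamma (of_real x * u) u = exp L"
        by (rule Zgamma_exp[OF small(2,1)])
      have "(\<lambda>j. of_real (poly (lpoly (j + 2)) x) * u ^ (j + 2)) sums L"
        using L(1) by (subst poly_lpoly) auto
      then have "(\<lambda>n. of_real (poly (lpoly n) x) * u ^ n) sums L"
        by (subst (asm) sums_iff_shift) (simp add: lpoly_def numeral_2_eq_2)
      moreover have "(\<lambda>n. of_real (poly (hpoly n) x) * u ^ n) sums exp L"
        using hpoly_sums[OF small] L(2) by simp
      ultimately show ?thesis by blast
    qed
    from exp_power_series_recurrence[of r "\<lambda>n. poly (lpoly n) x" "\<lambda>n. poly (hpoly n) x", OF r _ this]
    show "poly (hpoly 0) x = 1"
      "real (Suc n) * poly (hpoly (Suc n)) x = (\<Sum>k\<le>n. real (Suc k) * poly (lpoly (Suc k)) x * poly (hpoly (n - k)) x)"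
      by (simp_all add: lpoly_def)
  qed
  have "poly (hpoly 0) = poly 1"
    using *(1) by (simp add: fun_eq_iff)
  then show "hpoly 0 = 1"
    by (simp only: poly_eq_poly_eq_iff)
  have "poly (smult (real (Suc n)) (hpoly (Suc n))) = poly (\<Sum>k\<le>n. smult (real (Suc k)) (lpoly (Suc k) * hpoly (n - k)))"
    using *(2) by (simp add: fun_eq_iff poly_sum mult.assoc del: of_nat_Suc)
  then show "smult (real (Suc n)) (hpoly (Suc n)) = (\<Sum>k\<le>n. smult (real (Suc k)) (lpoly (Suc k) * hpoly (n - k)))"
    by (simp only: poly_eq_poly_eq_iff)
qed

text \<open>By induction, the recurrence builds each polynomial from earlier ones and the
  \<open>lpoly\<close> using ring operations and division by a positive integer.\<close>

lemma zeta_poly_hpoly: "zeta_poly (hpoly n)"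
proof (induction n rule: less_induct)
  case (less n)
  show ?case
  proof (cases n)
    case 0
    then show ?thesis by (simp add: hpoly_recurrence zeta_poly_1)
  next
    case (Suc m)
    have "hpoly n = smult (1 / real (Suc m)) (smult (real (Suc m)) (hpoly (Suc m)))"
      by (simp add: Suc del: of_nat_Suc)
    also have "\<dots> = smult (1 / real (Suc m)) (\<Sum>k\<le>m. smult (real (Suc k)) (lpoly (Suc k) * hpoly (m - k)))"
      by (simp only: hpoly_recurrence)
    also have "zeta_poly \<dots>"
      using less Suc by (intro zeta_poly_smult zeta_poly_sum zeta_poly_mult zeta_poly_lpoly) auto
    finally show ?thesis .
  qed
qed

text \<open>Since \<open>x\<close> is a free variable, the coefficient of \<open>x ^ a\<close> in
  total degree \<open>a + b\<close> isolates a single moment.\<close>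

lemma mcoeff_mem: "mcoeff a b \<in> zeta_ring"
proof -
  have "coeff (hpoly (a + b)) a = mcoeff a b"
    by (simp add: hpoly_def coeff_sum coeff_monom sum.delta)
  then show ?thesis
    using zeta_poly_hpoly[of "a + b"] by (metis zeta_poly_def)
qed

lemma moment_mem: "moment a b \<in> zeta_ring"
proof -
  have "moment a b = mcoeff a b * (fact a * fact b)"
    by (simp add: mcoeff_def)
  also have "\<dots> \<in> zeta_ring"
    by (intro zeta_ring.mult mcoeff_mem zeta_ring.rat fact_Rats)
  finally show ?thesis .
qed

section \<open>The claims in terms of integrals over the unit interval\<close>

lemma moment_has_integral:
  "((\<lambda>\<theta>. ln \<bar>2 * sin (pi * \<theta>)\<bar> ^ k * ln \<bar>2 * cos (pi * \<theta>)\<bar> ^ l) has_integral moment k l) {0..1}"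
proof -
  have "((\<lambda>\<theta>. ln \<bar>2 * sin (pi * \<theta>)\<bar> ^ k * ln \<bar>2 * cos (pi * \<theta>)\<bar> ^ l) has_integral
      (LINT \<theta>:reg|lborel. lsin \<theta> ^ k * lcos \<theta> ^ l)) {0..1}"
    by (rule has_integral_reg) (simp_all add: set_integrable_def moment_integrable lsin_def lcos_def flip: lsin_def lcos_def)
  then show ?thesis
    by (simp add: moment_def set_lebesgue_integral_def)
qed

lemma Zpm_eq_Zgamma:
  assumes "norm s < 1/2" "norm t < 1/2"
  shows "Zpm s t = Zgamma s t"
proof -
  have "Re s > -1" "Re t > -1"
    using assms abs_Re_le_cmod[of s] abs_Re_le_cmod[of t] by linarith+
  then show ?thesis
    unfolding Zpm_def by (intro integral_unique Zint_has_integral)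
qed

lemma Zpm_exp:
  assumes st: "norm s < 1/2" "norm t < 1/2"
  shows "\<exists>L. (\<lambda>j. let k = j + 2 in
              (- 1) ^ k / of_nat k * complex_of_real (rzeta k) *
              ((1 - 1 / 2 ^ k) * (s ^ k + t ^ k) - (1 / 2 ^ k) * (s + t) ^ k)) sums L
          \<and> Zpm s t = exp L"
proof -
  obtain L where L: "(\<lambda>j. logcoeff s t (j + 2) * of_real (rzeta (j + 2))) sums L" "Zgamma s t = exp L"
    by (rule Zgamma_exp[of s t]) (use st in auto)
  have *: "logcoeff s t k * of_real (rzeta k) = (- 1) ^ k / of_nat k * complex_of_real (rzeta k) *
            ((1 - 1 / 2 ^ k) * (s ^ k + t ^ k) - (1 / 2 ^ k) * (s + t) ^ k)" for k
    by (simp add: logcoeff_def)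
  show ?thesis
    unfolding Let_def by (rule exI[of _ L], rule conjI[OF L(1)[unfolded *]]) (simp only: Zpm_eq_Zgamma[OF st] L(2))
qed

lemma Zpm_has_sum:
  assumes "norm s < 1/2" "norm t < 1/2"
  shows "((\<lambda>(a, b). complex_of_real (mcoeff a b) * s ^ a * t ^ b) has_sum Zpm s t) UNIV"
  using mcoeff_has_sum[of s t] Zpm_eq_Zgamma[OF assms] assms by simp

theorem theorem12:
  shows
  "(\<forall>s t :: complex. Re s > -1 \<and> Re t > -1 \<longrightarrow>
      (Zint s t has_integral
         Gamma (s + 1) * Gamma (t + 1) /
         (Gamma (s / 2 + 1) * Gamma (t / 2 + 1) * Gamma ((s + t) / 2 + 1))) {0..1} \<and>
      ((\<lambda>n. let m = of_nat (Suc n) :: complex in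
           ((1 + s / (2 * m)) * (1 + t / (2 * m)) * (1 + (s + t) / (2 * m))) /
           ((1 + s / m) * (1 + t / m)))
        has_prod
         (Gamma (s + 1) * Gamma (t + 1) /
          (Gamma (s / 2 + 1) * Gamma (t / 2 + 1) * Gamma ((s + t) / 2 + 1)))))
   \<and>
   (\<exists>r > 0. \<forall>s t :: complex. norm s < r \<and> norm t < r \<longrightarrow>
      (\<exists>L. (\<lambda>j. let k = j + 2 in
              (- 1) ^ k / of_nat k * complex_of_real (rzeta k) *
              ((1 - 1 / 2 ^ k) * (s ^ k + t ^ k) - (1 / 2 ^ k) * (s + t) ^ k)) sums L
          \<and> Zpm s t = exp L))
   \<and>
   (\<exists>c :: nat \<Rightarrow> nat \<Rightarrow> real. (\<forall>a b. c a b \<in> zeta_ring) \<and>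
      (\<exists>r > 0. \<forall>s t :: complex. norm s < r \<and> norm t < r \<longrightarrow>
         ((\<lambda>(a, b). complex_of_real (c a b) * s ^ a * t ^ b) has_sum Zpm s t) UNIV))
   \<and>
   (\<forall>k l :: nat.
      (\<lambda>\<theta>. ln \<bar>2 * sin (pi * \<theta>)\<bar> ^ k * ln \<bar>2 * cos (pi * \<theta>)\<bar> ^ l) integrable_on {0..1} \<and>
      integral {0..1} (\<lambda>\<theta>. ln \<bar>2 * sin (pi * \<theta>)\<bar> ^ k * ln \<bar>2 * cos (pi * \<theta>)\<bar> ^ l)
        \<in> zeta_ring)"
proof (intro conjI allI impI)
  fix s t :: complex assume "Re s > -1 \<and> Re t > -1"
  then show "(Zint s t has_integral
       Gamma (s + 1) * Gamma (t + 1) /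
       (Gamma (s / 2 + 1) * Gamma (t / 2 + 1) * Gamma ((s + t) / 2 + 1))) {0..1}"
    and "(\<lambda>n. let m = of_nat (Suc n) :: complex in
         ((1 + s / (2 * m)) * (1 + t / (2 * m)) * (1 + (s + t) / (2 * m))) /
         ((1 + s / m) * (1 + t / m)))
      has_prod
       (Gamma (s + 1) * Gamma (t + 1) /
        (Gamma (s / 2 + 1) * Gamma (t / 2 + 1) * Gamma ((s + t) / 2 + 1)))"
    by (simp_all only: Zint_has_integral Zfactor_has_prod flip: Zgamma_def Zfactor_def)
next
  show "\<exists>r > 0. \<forall>s t :: complex. norm s < r \<and> norm t < r \<longrightarrow>
    (\<exists>L. (\<lambda>j. let k = j + 2 in
            (- 1) ^ k / of_nat k * complex_of_real (rzeta k) *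
            ((1 - 1 / 2 ^ k) * (s ^ k + t ^ k) - (1 / 2 ^ k) * (s + t) ^ k)) sums L
        \<and> Zpm s t = exp L)"
    by (rule exI[of _ "1/2"]) (use Zpm_exp in simp)
next
  show "\<exists>c :: nat \<Rightarrow> nat \<Rightarrow> real. (\<forall>a b. c a b \<in> zeta_ring) \<and>
    (\<exists>r > 0. \<forall>s t :: complex. norm s < r \<and> norm t < r \<longrightarrow>
       ((\<lambda>(a, b). complex_of_real (c a b) * s ^ a * t ^ b) has_sum Zpm s t) UNIV)"
    by (intro exI[of _ mcoeff] conjI allI mcoeff_mem exI[of _ "1/2"]) (use Zpm_has_sum in auto)
next
  fix k l
  show "(\<lambda>\<theta>. ln \<bar>2 * sin (pi * \<theta>)\<bar> ^ k * ln \<bar>2 * cos (pi * \<theta>)\<bar> ^ l) integrable_on {0..1}"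
    using moment_has_integral by blast
  show "integral {0..1} (\<lambda>\<theta>. ln \<bar>2 * sin (pi * \<theta>)\<bar> ^ k * ln \<bar>2 * cos (pi * \<theta>)\<bar> ^ l) \<in> zeta_ring"
    using moment_has_integral[of k l] moment_mem[of k l] by (simp add: integral_unique)
qed

end
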